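(* Let $n\ge2$, $\delta,\tau\in(0,1)$, $1\le s\le\frac{n}{n-\delta}$, $1\le q\le\frac{n}{s(n-\delta)}$ and $\alpha=n-sq(n-\delta)$. Let $\Omega\subset\mathbb{R}^n$ be an $s$-distance John domain with John constant $C_J\ge1$. Then there exists a constant $C>0$ depending only on $n,\tau,s,C_J$ and $\operatorname{diam}\Omega$ such that $$\left(\int_\Omega|f(x)|^q\frac{dx}{|x|^\alpha}\right)^{1/q}\le C(1-\delta)\int_\Omega\int_{\{x\in\Omega:\,|x-y|<\tau d(y)\}}\frac{|f(x)-f(y)|}{|x-y|^{n+\delta}}\,dx\,dy$$ for every $f\in L^1(\Omega)$ with $\frac{1}{|\Omega|}\int_\Omega f\,dx=0$.
   Context: A domain is a nonempty open connected set; $d(x)=\operatorname{dist}(x,\partial\Omega)$. A bounded domain $\Omega\subset\mathbb{R}^n$ is an $s$-distance John domain ($s\ge1$) with John constant $C_J\ge 1$ and John center $x_J\in\Omega$ if each $x\in\Omega$ can be joined to $x_J$ by a rectifiable curve $\gamma:[0,1]\to\Omega$, $\gamma(0)=x$, $\gamma(1)=x_J$, with $C_J\, d(\gamma(t))>|\gamma(t)-x|^s$ for all $t\in[0,1]$. *)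

theory Defs
  imports "HOL-Analysis.Analysis"
begin

definition rectifiable_on_unit :: "(real \<Rightarrow> 'a::metric_space) \<Rightarrow> bool" where
  "rectifiable_on_unit \<gamma> \<longleftrightarrow>
     (\<exists>L. \<forall>(N::nat) t. mono_on {..N} t \<and> t ` {..N} \<subseteq> {0..1} \<longrightarrow>
        (\<Sum>i<N. dist (\<gamma> (t i)) (\<gamma> (t (Suc i)))) \<le> L)"

definition bdry_dist :: "'a::metric_space set \<Rightarrow> 'a \<Rightarrow> real" where
  "bdry_dist \<Omega> x = infdist x (frontier \<Omega>)"

definition distance_John_domain ::
    "real \<Rightarrow> real \<Rightarrow> 'a::euclidean_space \<Rightarrow> 'a set \<Rightarrow> bool" where
  "distance_John_domain s C\<^sub>J x\<^sub>J \<Omega> \<longleftrightarrow>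
     \<Omega> \<noteq> {} \<and> open \<Omega> \<and> connected \<Omega> \<and> bounded \<Omega> \<and>
     s \<ge> 1 \<and> C\<^sub>J \<ge> 1 \<and> x\<^sub>J \<in> \<Omega> \<and>
     (\<forall>x\<in>\<Omega>. \<exists>\<gamma>. path \<gamma> \<and> rectifiable_on_unit \<gamma> \<and> path_image \<gamma> \<subseteq> \<Omega> \<and>
        \<gamma> 0 = x \<and> \<gamma> 1 = x\<^sub>J \<and>
        (\<forall>t\<in>{0..1}. C\<^sub>J * bdry_dist \<Omega> (\<gamma> t) > norm (\<gamma> t - x) powr s))"

text \<open>Only meant for exponents \<open>p > 0\<close>, where \<open>\<infinity>\<close> raised to \<open>p\<close> is \<open>\<infinity>\<close>.\<close>

definition ennreal_powr :: "ennreal \<Rightarrow> real \<Rightarrow> ennreal" where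
  "ennreal_powr a p = (if a = \<infinity> then \<infinity> else ennreal (enn2real a powr p))"

text \<open>
  The two sides of the inequality take values in \<open>[0, \<infinity>]\<close>. The arbitrary values of the
  integrands at \<open>x = 0\<close> (where \<open>0 powr \<alpha> = 0\<close>, even for \<open>\<alpha> = 0\<close>)
  and at \<open>x = y\<close> only concern null sets.
\<close>

definition weighted_Lq_norm ::
    "real \<Rightarrow> real \<Rightarrow> 'a::euclidean_space set \<Rightarrow> ('a \<Rightarrow> real) \<Rightarrow> ennreal" where
  "weighted_Lq_norm q \<alpha> \<Omega> f =
     ennreal_powr (\<integral>\<^sup>+x\<in>\<Omega>. ennreal (\<bar>f x\<bar> powr q / norm x powr \<alpha>) \<partial>lebesgue) (1 / q)"

definition truncated_fractional_seminorm ::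
    "real \<Rightarrow> real \<Rightarrow> 'a::euclidean_space set \<Rightarrow> ('a \<Rightarrow> real) \<Rightarrow> ennreal" where
  "truncated_fractional_seminorm \<delta> \<tau> \<Omega> f =
     (\<integral>\<^sup>+y\<in>\<Omega>.
        (\<integral>\<^sup>+x\<in>{x\<in>\<Omega>. norm (x - y) < \<tau> * bdry_dist \<Omega> y}.
           ennreal (\<bar>f x - f y\<bar> / norm (x - y) powr (real DIM('a) + \<delta>)) \<partial>lebesgue)
        \<partial>lebesgue)"

end

theory Submission
  imports Defs
begin

text \<open>
  By the coarea formula the truncated seminorm of \<open>u\<close> is the integral over \<open>t\<close> of the fractional
  perimeters of \<open>{u > t}\<close>, so everything reduces to the relative isoperimetric inequality
  \<open>|E| powr \<theta> \<le> K (1 - \<delta>) P(E)\<close> with \<open>\<theta> = s (n - \<delta>) / n \<le> 1\<close>, for sets \<open>E\<close> that fill at most half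
  of the central Whitney ball. Going from a density point \<open>x\<close> of \<open>E\<close> along the John curve one meets,
  by continuity, a Whitney ball of radius \<open>r\<close> in which \<open>E\<close> has density exactly one half, and whose
  distance to \<open>x\<close> is at most a multiple of \<open>r powr (1 / s)\<close>. Such a ball contributes at least
  \<open>c r powr (n - \<delta>) / (1 - \<delta>)\<close> to \<open>P(E)\<close>, which follows from repeatedly halving segments.
  A Vitali covering by the balls of radius \<open>K r powr (1 / s)\<close> around the points \<open>x\<close> gives the claim.

  The weight satisfies \<open>w(A) \<le> K |A| powr (1 - \<alpha> / n) = K |A| powr (\<theta> q)\<close>, so the bound on
  the integral of \<open>|{u > t}| powr \<theta>\<close> controls the weighted \<open>L\<^sup>q\<close> norm as well as the \<open>L\<^sup>1\<close> norm of the positive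
  and negative parts of \<open>f - m\<close>, where \<open>m\<close> is a median of \<open>f\<close> on the central ball. As \<open>f\<close> has
  mean zero, the \<open>L\<^sup>1\<close> bound controls \<open>m\<close>.
\<close>

subsection \<open>Pairs separated by a set\<close>

definition separated_pairs :: "'a::metric_space set \<Rightarrow> 'a set \<Rightarrow> real \<Rightarrow> ('a \<times> 'a) set" where
  "separated_pairs B E \<rho> = {(x, y). x \<in> B \<and> y \<in> B \<and> dist x y < \<rho> \<and> (x \<in> E) \<noteq> (y \<in> E)}"

lemma separated_pairs_borel [measurable]:
  fixes B :: "'a::euclidean_space set"
  assumes [measurable]: "B \<in> sets borel" "E \<in> sets borel"
  shows "separated_pairs B E \<rho> \<in> sets borel"
proof -
  have "separated_pairs B E \<rho> =
      {p \<in> space (borel \<Otimes>\<^sub>M borel). fst p \<in> B \<and> snd p \<in> B \<and> dist (fst p) (snd p) < \<rho> \<and> (fst p \<in> E) \<noteq> (snd p \<in> E)}"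
    by (auto simp: separated_pairs_def space_pair_measure)
  also have "\<dots> \<in> sets (borel \<Otimes>\<^sub>M borel)"
    by measurable
  finally show ?thesis by (simp only: borel_prod)
qed

section \<open>Changes of variables in the space of pairs\<close>

lemma emeasure_lborel_vimage_affine:
  fixes A :: "'a::euclidean_space set"
  assumes [measurable]: "A \<in> sets borel" and c: "c \<noteq> 0"
  shows "emeasure lborel A = ennreal (\<bar>c\<bar> ^ DIM('a)) * emeasure lborel ((\<lambda>x. t + c *\<^sub>R x) -` A)"
proof -
  have "emeasure lborel A
      = emeasure (density (distr lborel borel (\<lambda>x. t + c *\<^sub>R x)) (\<lambda>_. \<bar>c\<bar> ^ DIM('a))) A"
    using lborel_affine[OF c, of t] by metis
  also have "\<dots> = ennreal (\<bar>c\<bar> ^ DIM('a)) * emeasure (distr lborel borel (\<lambda>x. t + c *\<^sub>R x)) A"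
    by (subst emeasure_density_const) auto
  also have "emeasure (distr lborel borel (\<lambda>x. t + c *\<^sub>R x)) A = emeasure lborel ((\<lambda>x. t + c *\<^sub>R x) -` A)"
    by (subst emeasure_distr) auto
  finally show ?thesis .
qed

text \<open>The map keeps \<open>x\<close> and moves \<open>y\<close> to the midpoint. On each slice
  with \<open>x\<close> fixed it is affine with ratio \<open>1/2\<close>, so preimages gain the
  factor \<open>2 ^ DIM('a)\<close>; Tonelli's theorem collects the slices.\<close>

lemma emeasure_lborel_half_snd:
  fixes S :: "('a::euclidean_space \<times> 'a) set"
  assumes S: "S \<in> sets borel"
  shows "emeasure lborel ((\<lambda>p. (fst p, (1/2) *\<^sub>R fst p + (1/2) *\<^sub>R snd p)) -` S)
       = ennreal (2 ^ DIM('a)) * emeasure lborel S" (is "emeasure _ (?T -` S) = _")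
proof -
  have S' [measurable]: "S \<in> sets (lborel \<Otimes>\<^sub>M lborel)"
    using S by (metis lborel_prod sets_lborel)
  have T: "?T -` S \<in> sets (lborel \<Otimes>\<^sub>M lborel)"
    unfolding lborel_prod sets_lborel
    by (rule measurable_sets_borel[OF _ S]) (intro borel_measurable_continuous_onI continuous_intros)
  have slice: "emeasure lborel (Pair x -` (?T -` S)) = ennreal (2 ^ DIM('a)) * emeasure lborel (Pair x -` S)" for x
  proof -
    have [measurable]: "Pair x -` S \<in> sets borel"
      using sets_Pair1[OF S', of x] by simp
    have "ennreal (2 ^ DIM('a)) * emeasure lborel (Pair x -` S)
        = ennreal (2 ^ DIM('a)) * (ennreal ((1/2) ^ DIM('a)) *
            emeasure lborel ((\<lambda>y. (1/2) *\<^sub>R x + (1/2) *\<^sub>R y) -` (Pair x -` S)))"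
      by (subst emeasure_lborel_vimage_affine[where c = "1/2" and t = "(1/2) *\<^sub>R x"]) auto
    also have "\<dots> = emeasure lborel ((\<lambda>y. (1/2) *\<^sub>R x + (1/2) *\<^sub>R y) -` (Pair x -` S))"
      by (simp add: mult.assoc[symmetric] ennreal_mult[symmetric] power_mult_distrib[symmetric])
    finally show ?thesis
      by (simp add: vimage_def)
  qed
  have "emeasure (lborel \<Otimes>\<^sub>M lborel) (?T -` S) = (\<integral>\<^sup>+x. emeasure lborel (Pair x -` (?T -` S)) \<partial>lborel)"
    by (rule lborel.emeasure_pair_measure_alt[OF T])
  also have "\<dots> = (\<integral>\<^sup>+x. ennreal (2 ^ DIM('a)) * emeasure lborel (Pair x -` S) \<partial>lborel)"
    by (simp only: slice)
  also have "\<dots> = ennreal (2 ^ DIM('a)) * (\<integral>\<^sup>+x. emeasure lborel (Pair x -` S) \<partial>lborel)"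
    by (intro nn_integral_cmult) (rule lborel.measurable_emeasure_Pair[OF S'])
  also have "(\<integral>\<^sup>+x. emeasure lborel (Pair x -` S) \<partial>lborel) = emeasure (lborel \<Otimes>\<^sub>M lborel) S"
    by (rule lborel.emeasure_pair_measure_alt[OF S', symmetric])
  finally show ?thesis by (simp add: lborel_prod)
qed

lemma emeasure_lborel_swap:
  fixes S :: "('a::euclidean_space \<times> 'a) set"
  assumes S: "S \<in> sets borel"
  shows "emeasure lborel (prod.swap -` S) = emeasure lborel S"
proof -
  have S' [measurable]: "S \<in> sets (lborel \<Otimes>\<^sub>M lborel)"
    using S by (metis lborel_prod sets_lborel)
  have V: "prod.swap -` S \<in> sets (lborel \<Otimes>\<^sub>M lborel)"
    unfolding lborel_prod sets_lborel
    by (rule measurable_sets_borel[OF _ S]) (intro borel_measurable_continuous_onI continuous_on_swap)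
  have "emeasure (lborel \<Otimes>\<^sub>M lborel) (prod.swap -` S) = emeasure (lborel \<Otimes>\<^sub>M lborel) S"
    unfolding lborel.emeasure_pair_measure_alt[OF V] lborel_pair.emeasure_pair_measure_alt2[OF S']
    by (simp add: vimage_def)
  then show ?thesis by (simp add: lborel_prod)
qed

text \<open>If \<open>x\<close> and \<open>y\<close> are separated by \<open>E\<close>, then their midpoint is separated from one of them.\<close>

lemma emeasure_separated_pairs_halve:
  fixes B :: "'a::euclidean_space set"
  assumes B: "B \<in> sets borel" "convex B" and E: "E \<in> sets borel"
  shows "emeasure lborel (separated_pairs B E \<rho>)
    \<le> ennreal (2 ^ Suc DIM('a)) * emeasure lborel (separated_pairs B E (\<rho> / 2))"
proof -
  let ?S = "separated_pairs B E" and ?T = "\<lambda>p. (fst p, (1/2) *\<^sub>R fst p + (1/2) *\<^sub>R snd p)"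
  let ?V = "?T -` ?S (\<rho> / 2)"
  have S: "?S r \<in> sets borel" for r using B E by measurable
  have V: "?V \<in> sets borel"
    by (rule measurable_sets_borel[OF _ S]) (intro borel_measurable_continuous_onI continuous_intros)
  have swap: "prod.swap -` ?V \<in> sets borel"
    by (rule measurable_sets_borel[OF _ V]) (intro borel_measurable_continuous_onI continuous_on_swap)
  have "?S \<rho> \<subseteq> ?V \<union> prod.swap -` ?V"
  proof
    fix p assume "p \<in> ?S \<rho>"
    then obtain x y where p: "p = (x, y)" and xy: "x \<in> B" "y \<in> B" "dist x y < \<rho>" "(x \<in> E) \<noteq> (y \<in> E)"
      by (auto simp: separated_pairs_def)
    define m where "m = (1/2) *\<^sub>R x + (1/2) *\<^sub>R y"
    have mB: "m \<in> B" using xy B(2) unfolding m_def by (intro convexD) auto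
    have mid: "m = midpoint x y" by (simp add: m_def midpoint_def scaleR_add_right)
    have d: "dist x m < \<rho> / 2" "dist y m < \<rho> / 2" using xy(3) by (simp_all add: mid dist_midpoint)
    have sym: "(1/2) *\<^sub>R y + (1/2) *\<^sub>R x = m" by (simp add: m_def)
    show "p \<in> ?V \<union> prod.swap -` ?V"
      using xy mB d by (auto simp: p separated_pairs_def sym m_def[symmetric])
  qed
  then have "emeasure lborel (?S \<rho>) \<le> emeasure lborel (?V \<union> prod.swap -` ?V)"
    using V swap by (intro emeasure_mono) auto
  also have "\<dots> \<le> emeasure lborel ?V + emeasure lborel (prod.swap -` ?V)"
    using V swap by (intro emeasure_subadditive) auto
  also have "\<dots> = 2 * emeasure lborel ?V"
    using emeasure_lborel_swap[OF V] by (simp add: mult_2)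
  \<comment> \<open>One factor \<open>2\<close> counts the two covering pieces, the others are the
    Jacobian of the midpoint map.\<close>
  also have "\<dots> = ennreal (2 ^ Suc DIM('a)) * emeasure lborel (?S (\<rho> / 2))"
    by (subst emeasure_lborel_half_snd[OF S]) (simp add: ennreal_mult mult.assoc)
  finally show ?thesis .
qed

lemma emeasure_separated_pairs_dyadic:
  fixes B :: "'a::euclidean_space set"
  assumes "B \<in> sets borel" "convex B" "E \<in> sets borel"
  shows "emeasure lborel (separated_pairs B E \<rho>)
    \<le> ennreal ((2 ^ Suc DIM('a)) ^ j) * emeasure lborel (separated_pairs B E (\<rho> / 2 ^ j))"
proof (induction j)
  case (Suc j)
  have "emeasure lborel (separated_pairs B E \<rho>)
      \<le> ennreal ((2 ^ Suc DIM('a)) ^ j) * emeasure lborel (separated_pairs B E (\<rho> / 2 ^ j))"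
    by (rule Suc)
  also have "\<dots> \<le> ennreal ((2 ^ Suc DIM('a)) ^ j) *
      (ennreal (2 ^ Suc DIM('a)) * emeasure lborel (separated_pairs B E (\<rho> / 2 ^ j / 2)))"
    by (intro mult_left_mono emeasure_separated_pairs_halve assms) auto
  also have "\<dots> = ennreal ((2 ^ Suc DIM('a)) ^ Suc j) *
      emeasure lborel (separated_pairs B E (\<rho> / 2 ^ Suc j))"
    by (simp add: ennreal_mult mult_ac)
  finally show ?case .
qed simp

text \<open>The sum is dominated by its last non-zero term, since the ratio of the terms is at least \<open>2\<close>.\<close>

lemma sum_dyadic_powr_le:
  fixes R d p :: real
  assumes "0 < d" "0 < R" "1 \<le> p"
  shows "(\<Sum>j<N. if d < R / 2 ^ j then (R / 2 ^ j) powr (-p) else 0) \<le> 2 * d powr (-p)"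
proof -
  define b where "b j = (R / 2 ^ j) powr (-p)" for j :: nat
  have step: "2 * b j \<le> b (Suc j)" for j
  proof -
    have "b (Suc j) = (R / 2 ^ j * (1/2)) powr (-p)" by (simp add: b_def mult.commute)
    also have "\<dots> = b j * (1/2) powr (-p)" using assms unfolding b_def by (subst powr_mult) auto
    also have "(1/2::real) powr (-p) = 2 powr p" by (simp add: powr_divide powr_minus_divide)
    also have "b j * 2 powr p \<ge> b j * 2 powr 1"
      using assms by (intro mult_left_mono powr_mono) (auto simp: b_def)
    finally show ?thesis by simp
  qed
  have geo: "(\<Sum>j<Suc N. b j) \<le> 2 * b N" for N
  proof (induction N)
    case (Suc N)
    then show ?case using step[of N] by simp
  qed (simp add: b_def)
  show ?thesis
  proof (induction N)
    case (Suc N)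
    show ?case
    \<comment> \<open>The scales decrease, so if the last one exceeds \<open>d\<close>, all of them
      do and the full geometric sum applies; otherwise the last term is \<open>0\<close>.\<close>
    proof (cases "d < R / 2 ^ N")
      case True
      have "d < R / 2 ^ j" if "j < Suc N" for j
        using True that assms by (intro less_le_trans[OF True] divide_left_mono power_increasing) auto
      then have "(\<Sum>j<Suc N. if d < R / 2 ^ j then (R / 2 ^ j) powr (-p) else 0) = (\<Sum>j<Suc N. b j)"
        by (intro sum.cong) (auto simp: b_def)
      also have "\<dots> \<le> 2 * b N" by (rule geo)
      also have "\<dots> \<le> 2 * d powr (-p)"
        using True assms unfolding b_def by (intro mult_left_mono powr_mono2') auto
      finally show ?thesis .
    qed (use Suc in simp)
  qed (use assms in simp)
qed

section \<open>Lower bound for the kernel integral over a half-filled ball\<close>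

definition kernel_integral :: "real \<Rightarrow> ('a::euclidean_space \<times> 'a) set \<Rightarrow> ennreal" where
  "kernel_integral p A = (\<integral>\<^sup>+z. ennreal (norm (fst z - snd z) powr (-p)) * indicator A z \<partial>lborel)"

lemma borel_measurable_fst_borel [measurable]:
  "fst \<in> borel_measurable (borel :: ('a::topological_space \<times> 'b::topological_space) measure)"
  by (intro borel_measurable_continuous_onI continuous_intros)

lemma borel_measurable_snd_borel [measurable]:
  "snd \<in> borel_measurable (borel :: ('a::topological_space \<times> 'b::topological_space) measure)"
  by (intro borel_measurable_continuous_onI continuous_intros)

lemma borel_measurable_kernel [measurable]:
  "(\<lambda>z. norm (fst z - snd z) powr p) \<in> borel_measurable (borel :: ('a::euclidean_space \<times> 'a) measure)"
  by measurable

text \<open>At scale \<open>R\<close> every point of \<open>B \<inter> E\<close> is paired with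
  every point of \<open>B - E\<close>, which yields a quarter of the squared volume. Each halving of
  the scale costs the factor \<open>2 ^ Suc DIM('a)\<close>.\<close>

lemma emeasure_separated_pairs_ge:
  fixes B :: "'a::euclidean_space set"
  assumes B: "B \<in> sets borel" "convex B" "\<And>x y. x \<in> B \<Longrightarrow> y \<in> B \<Longrightarrow> dist x y < R"
    and Bfin: "emeasure lborel B < \<infinity>"
    and E: "E \<in> sets borel" and half: "2 * measure lborel (B \<inter> E) = measure lborel B"
  shows "ennreal ((measure lborel B)\<^sup>2 / 4 / (2 ^ Suc DIM('a)) ^ j)
    \<le> emeasure lborel (separated_pairs B E (R / 2 ^ j))"
proof -
  have BE: "B \<inter> E \<in> sets borel" "B - E \<in> sets borel" using B E by auto
  have fin: "emeasure lborel (B \<inter> E) \<noteq> \<infinity>" "emeasure lborel (B - E) \<noteq> \<infinity>"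
    using emeasure_mono[of "B \<inter> E" B lborel] emeasure_mono[of "B - E" B lborel] B(1) Bfin
    by (auto simp: top_unique less_top[symmetric])
  have "B - B \<inter> E = B - E" by auto
  then have "measure lborel (B - E) = measure lborel B - measure lborel (B \<inter> E)"
    using measure_Diff[of lborel B "B \<inter> E"] B E Bfin by auto
  then have m: "measure lborel (B - E) = measure lborel B / 2" "measure lborel (B \<inter> E) = measure lborel B / 2"
    using half by auto
  have "ennreal ((measure lborel B)\<^sup>2 / 4) = ennreal (measure lborel (B \<inter> E) * measure lborel (B - E))"
    by (simp add: m power2_eq_square)
  also have "\<dots> = emeasure lborel (B \<inter> E) * emeasure lborel (B - E)"
    using fin by (simp add: ennreal_mult emeasure_eq_ennreal_measure)
  also have "\<dots> = emeasure (lborel \<Otimes>\<^sub>M lborel) ((B \<inter> E) \<times> (B - E))"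
    using BE by (subst lborel.emeasure_pair_measure_Times) auto
  also have "\<dots> \<le> emeasure lborel (separated_pairs B E R)"
    unfolding lborel_prod using separated_pairs_borel[OF B(1) E, of R] B(3)
    by (intro emeasure_mono) (auto simp: separated_pairs_def)
  also have "\<dots> \<le> ennreal ((2 ^ Suc DIM('a)) ^ j) * emeasure lborel (separated_pairs B E (R / 2 ^ j))"
    by (intro emeasure_separated_pairs_dyadic B E)
  finally have "ennreal ((measure lborel B)\<^sup>2 / 4) * ennreal (1 / (2 ^ Suc DIM('a)) ^ j) \<le>
      ennreal ((2 ^ Suc DIM('a)) ^ j) * emeasure lborel (separated_pairs B E (R / 2 ^ j)) *
        ennreal (1 / (2 ^ Suc DIM('a)) ^ j)"
    by (rule mult_right_mono) simp
  also have "\<dots> = (ennreal ((2 ^ Suc DIM('a)) ^ j) * ennreal (1 / (2 ^ Suc DIM('a)) ^ j)) *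
      emeasure lborel (separated_pairs B E (R / 2 ^ j))"
    by (simp only: mult_ac)
  also have "\<dots> = emeasure lborel (separated_pairs B E (R / 2 ^ j))"
    by (simp add: ennreal_mult[symmetric] del: power_Suc)
  finally show ?thesis
    by (simp add: ennreal_mult[symmetric] del: power_Suc)
qed

text \<open>With \<open>e = 1 - \<delta>\<close> this compares the sum \<open>1 / (1 - a)\<close> of
  the geometric series of ratio \<open>a = 2 powr (\<delta> - 1)\<close> with
  \<open>1 / (1 - \<delta>)\<close>.\<close>

lemma one_minus_two_powr_le:
  fixes e :: real
  assumes "0 \<le> e"
  shows "1 - 2 powr (-e) \<le> e"
proof -
  have "1 + (-e) * ln 2 \<le> exp ((-e) * ln 2)" by (rule exp_ge_add_one_self)
  moreover have "e * ln 2 \<le> e" using assms ln2_le_25_over_36 by (intro mult_left_le) auto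
  ultimately show ?thesis by (simp add: powr_def)
qed

text \<open>The factor \<open>1 - \<delta>\<close> arises from summing the geometric series with ratio \<open>2 powr (\<delta> - 1)\<close>
  over dyadic scales.\<close>

lemma kernel_integral_separated_pairs_ge:
  fixes z :: "'a::euclidean_space" and r \<delta> :: real
  assumes r: "0 < r" and \<delta>: "0 < \<delta>" "\<delta> < 1" and E: "E \<in> sets borel"
    and half: "2 * measure lborel (ball z r \<inter> E) = measure lborel (ball z r)"
  shows "ennreal ((unit_ball_vol DIM('a))\<^sup>2 / 2 ^ (DIM('a) + 4) * r powr (DIM('a) - \<delta>))
    \<le> ennreal (1 - \<delta>) * kernel_integral (DIM('a) + \<delta>) (separated_pairs (ball z r) E (2 * r))"
proof -
  define n where "n = DIM('a)"
  define B where "B = ball z r"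
  define p where "p = real n + \<delta>"
  define R where "R = 2 * r"
  define V where "V = measure lborel B"
  define a where "a = 2 powr (\<delta> - 1)"
  define S where "S j = separated_pairs B E (R / 2 ^ j)" for j :: nat
  define I where "I = kernel_integral p (S 0)"
  have n: "n \<ge> 1" by (simp add: n_def Suc_le_eq)
  have p: "1 \<le> p" using n \<delta> by (simp add: p_def)
  have B: "B \<in> sets borel" "convex B" "emeasure lborel B < \<infinity>"
    using r by (simp_all add: B_def emeasure_ball)
  have S_borel [measurable]: "S j \<in> sets borel" for j
    unfolding S_def using B(1) E by measurable
  have dist_B: "dist x y < R" if "x \<in> B" "y \<in> B" for x y
    using that dist_triangle2[of x y z] by (auto simp: B_def R_def dist_commute)
  have H: "ennreal (V\<^sup>2 / 4 / (2 ^ Suc n) ^ j) \<le> emeasure lborel (S j)" for j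
    unfolding S_def V_def n_def
    by (intro emeasure_separated_pairs_ge B E dist_B) (use half in \<open>auto simp: B_def\<close>)
  have a: "0 < a" "a < 1" using \<delta> powr_less_mono[of "\<delta> - 1" 0 2] by (auto simp: a_def)
  \<comment> \<open>Passing from \<open>j\<close> to \<open>j + 1\<close> multiplies the kernel by
    \<open>2 powr p\<close> and the bound \<open>H\<close> by \<open>1 / 2 ^ Suc n\<close>; as
    \<open>p = n + \<delta>\<close>, the ratio is \<open>2 powr (\<delta> - 1)\<close>.\<close>
  have term_eq: "(R / 2 ^ j) powr (-p) * (V\<^sup>2 / 4 / (2 ^ Suc n) ^ j) = V\<^sup>2 / 4 * R powr (-p) * a ^ j" for j
  proof -
    have "(R / 2 ^ j) powr (-p) = R powr (-p) * (2 powr p) ^ j"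
      using r by (simp add: R_def powr_divide powr_minus powr_power divide_simps powr_powr powr_realpow[symmetric] mult.commute)
    moreover have "(2 powr p) / 2 ^ Suc n = a"
      using powr_diff[of 2 p "real (Suc n)"]
      by (simp add: a_def p_def powr_realpow[symmetric] del: power_Suc)
    then have "(2 powr p) ^ j / (2 ^ Suc n) ^ j = a ^ j"
      by (simp add: power_divide[symmetric] del: power_Suc)
    ultimately show ?thesis by (simp add: field_simps del: power_Suc)
  qed
  have partial: "ennreal (V\<^sup>2 / 8 * R powr (-p) * (1 - a ^ N)) \<le> ennreal (1 - \<delta>) * I" for N
  proof -
    have "ennreal (\<Sum>j<N. V\<^sup>2 / 4 * R powr (-p) * a ^ j)
        = (\<Sum>j<N. ennreal ((R / 2 ^ j) powr (-p)) * ennreal (V\<^sup>2 / 4 / (2 ^ Suc n) ^ j))"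
      unfolding term_eq[symmetric]
      by (subst sum_ennreal[symmetric]) (auto simp: ennreal_mult[symmetric] simp del: power_Suc)
    also have "\<dots> \<le> (\<Sum>j<N. ennreal ((R / 2 ^ j) powr (-p)) * emeasure lborel (S j))"
      by (intro sum_mono mult_left_mono H) auto
    also have "\<dots> = (\<Sum>j<N. \<integral>\<^sup>+w. ennreal ((R / 2 ^ j) powr (-p)) * indicator (S j) w \<partial>lborel)"
      by (intro sum.cong refl nn_integral_cmult_indicator[symmetric]) simp
    also have "\<dots> = (\<integral>\<^sup>+w. (\<Sum>j<N. ennreal ((R / 2 ^ j) powr (-p)) * indicator (S j) w) \<partial>lborel)"
      by (rule nn_integral_sum[symmetric]) measurable
    \<comment> \<open>At a pair of distance \<open>d\<close> only the scales above \<open>d\<close>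
      contribute, and \<open>sum_dyadic_powr_le\<close> collapses them to twice the kernel.\<close>
    also have "\<dots> \<le> (\<integral>\<^sup>+w. 2 * (ennreal (norm (fst w - snd w) powr (-p)) * indicator (S 0) w) \<partial>lborel)"
    proof (intro nn_integral_mono)
      fix w :: "'a \<times> 'a"
      obtain x y where w: "w = (x, y)" by (cases w)
      show "(\<Sum>j<N. ennreal ((R / 2 ^ j) powr (-p)) * indicator (S j) w)
          \<le> 2 * (ennreal (norm (fst w - snd w) powr (-p)) * indicator (S 0) w)"
      proof (cases "w \<in> S 0")
        case True
        \<comment> \<open>Separated points are distinct, so the default value
          \<open>0 powr (-p) = 0\<close> of the kernel on the diagonal does not interfere.\<close>
        then have xy: "x \<in> B" "y \<in> B" "(x \<in> E) \<noteq> (y \<in> E)" "x \<noteq> y"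
          by (auto simp: S_def separated_pairs_def w)
        have "ennreal ((R / 2 ^ j) powr (-p)) * indicator (S j) w
            = ennreal (if dist x y < R / 2 ^ j then (R / 2 ^ j) powr (-p) else 0)" for j
          using xy by (auto simp: S_def separated_pairs_def w)
        then have "(\<Sum>j<N. ennreal ((R / 2 ^ j) powr (-p)) * indicator (S j) w)
            = ennreal (\<Sum>j<N. if dist x y < R / 2 ^ j then (R / 2 ^ j) powr (-p) else 0)"
          by (simp only:) (intro sum_ennreal, auto)
        also have "\<dots> \<le> ennreal (2 * dist x y powr (-p))"
          using xy r p by (intro ennreal_leI sum_dyadic_powr_le) (auto simp: R_def)
        finally show ?thesis using True by (simp add: w dist_norm ennreal_mult)
      next
        case False
        have "w \<notin> S j" for j
          using False dist_B by (auto simp: S_def separated_pairs_def w)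
        then show ?thesis by simp
      qed
    qed
    also have "\<dots> = 2 * I"
      unfolding I_def kernel_integral_def by (rule nn_integral_cmult) simp
    finally have "ennreal (\<Sum>j<N. V\<^sup>2 / 4 * R powr (-p) * a ^ j) \<le> 2 * I" .
    then have "ennreal ((1 - \<delta>) / 2) * ennreal (\<Sum>j<N. V\<^sup>2 / 4 * R powr (-p) * a ^ j)
        \<le> ennreal ((1 - \<delta>) / 2) * (2 * I)"
      by (rule mult_left_mono) simp
    also have "\<dots> = ennreal (1 - \<delta>) * I"
    proof -
      have "ennreal ((1 - \<delta>) / 2) * 2 = ennreal (1 - \<delta>)"
        using \<delta> by (simp add: ennreal_numeral[symmetric] ennreal_mult[symmetric] del: ennreal_numeral)
      then show ?thesis by (simp add: mult.assoc[symmetric])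
    qed
    finally have *: "ennreal ((1 - \<delta>) / 2 * (\<Sum>j<N. V\<^sup>2 / 4 * R powr (-p) * a ^ j)) \<le> ennreal (1 - \<delta>) * I"
      using \<delta> a by (simp add: ennreal_mult[symmetric] sum_nonneg)
    have geo: "(\<Sum>j<N. V\<^sup>2 / 4 * R powr (-p) * a ^ j) = V\<^sup>2 / 4 * R powr (-p) * ((1 - a ^ N) / (1 - a))"
      using a by (subst sum_distrib_left[symmetric]) (simp add: sum_gp_strict)
    have "1 - a \<le> 1 - \<delta>"
      using one_minus_two_powr_le[of "1 - \<delta>"] \<delta> by (simp add: a_def)
    then have "1 \<le> (1 - \<delta>) / (1 - a)" using a by simp
    then have "V\<^sup>2 / 8 * R powr (-p) * (1 - a ^ N) * 1 \<le> V\<^sup>2 / 8 * R powr (-p) * (1 - a ^ N) * ((1 - \<delta>) / (1 - a))"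
      using a by (intro mult_left_mono) (auto simp: power_le_one)
    also have "\<dots> = (1 - \<delta>) / 2 * (\<Sum>j<N. V\<^sup>2 / 4 * R powr (-p) * a ^ j)"
      unfolding geo using a by (simp add: divide_simps)
    finally show ?thesis using * by (intro order_trans[OF ennreal_leI *]) simp
  qed
  \<comment> \<open>Letting \<open>N\<close> tend to infinity removes the factor
    \<open>1 - a ^ N\<close> left by the finite geometric sums.\<close>
  have "(\<lambda>N. ennreal (V\<^sup>2 / 8 * R powr (-p) * (1 - a ^ N))) \<longlonglongrightarrow> ennreal (V\<^sup>2 / 8 * R powr (-p) * (1 - 0))"
    using a by (intro tendsto_ennrealI tendsto_intros LIMSEQ_power_zero) auto
  then have lim: "ennreal (V\<^sup>2 / 8 * R powr (-p)) \<le> ennreal (1 - \<delta>) * I"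
    using partial by (intro LIMSEQ_le_const2[where a = "ennreal (1 - \<delta>) * I"]) auto
  have "(unit_ball_vol n)\<^sup>2 / 2 ^ (n + 4) * r powr (n - \<delta>) \<le> V\<^sup>2 / 8 * R powr (-p)"
  proof -
    have "V = unit_ball_vol n * r ^ n"
      using r by (simp add: V_def B_def n_def measure_def emeasure_ball)
    moreover have "r powr (2 * real n) = (r ^ n)\<^sup>2"
      using r powr_realpow[of r "2 * n"] by (simp add: power_mult[symmetric] mult.commute)
    ultimately have V2: "V\<^sup>2 = (unit_ball_vol n)\<^sup>2 * r powr (2 * real n)"
      by (simp add: power_mult_distrib)
    \<comment> \<open>Since \<open>p \<le> n + 1\<close>, the power of \<open>2\<close> in
      \<open>R = 2 * r\<close> is bounded independently of \<open>\<delta>\<close>; the final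
      denominator is \<open>8 * 2 ^ (n + 1) = 2 ^ (n + 4)\<close>.\<close>
    have "(1/2::real) ^ (n + 1) \<le> 2 powr (-p)"
    proof -
      have "(1/2::real) ^ (n + 1) = 2 powr (- real (n + 1))"
        unfolding powr_minus by (subst powr_realpow) (auto simp: power_one_over inverse_eq_divide)
      also have "\<dots> \<le> 2 powr (-p)" using \<delta> by (intro powr_mono) (auto simp: p_def)
      finally show ?thesis .
    qed
    then have "(unit_ball_vol n)\<^sup>2 / 8 * r powr (n - \<delta>) * (1/2) ^ (n + 1)
        \<le> (unit_ball_vol n)\<^sup>2 / 8 * r powr (n - \<delta>) * 2 powr (-p)"
      by (intro mult_left_mono) auto
    also have "\<dots> = V\<^sup>2 / 8 * R powr (-p)"
    proof -
      have "R powr (-p) = 2 powr (-p) * r powr (-p)" using r by (simp add: R_def powr_mult)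
      moreover have "r powr (2 * real n) * r powr (-p) = r powr (n - \<delta>)"
        by (simp add: powr_add[symmetric] p_def)
      ultimately show ?thesis by (simp add: V2)
    qed
    finally show ?thesis by (simp add: power_add power_one_over field_simps)
  qed
  from order_trans[OF ennreal_leI[OF this] lim] show ?thesis
    by (simp add: n_def p_def I_def S_def R_def B_def)
qed

subsection \<open>Balls of density one half in John domains\<close>

text \<open>A weak form of Lebesgue's density theorem. Take an open \<open>U\<close> around
  \<open>S\<close> of measure at most \<open>|S| + e\<close>. Disjoint Vitali balls in
  \<open>U\<close>, each at most half filled by \<open>S\<close>, cover almost all of
  \<open>S\<close>, so \<open>|S| \<le> (|S| + e) / 2\<close>, that is
  \<open>|S| \<le> e\<close>.\<close>

lemma negligible_if_density_le_half:
  fixes S :: "'a::euclidean_space set"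
  assumes S: "S \<in> lmeasurable"
    and dens: "\<And>x d. x \<in> S \<Longrightarrow> 0 < d \<Longrightarrow>
      \<exists>r. 0 < r \<and> r < d \<and> 2 * measure lebesgue (S \<inter> ball x r) \<le> measure lebesgue (ball x r)"
  shows "negligible S"
proof -
  let ?\<mu> = "measure lebesgue"
  have "?\<mu> S \<le> 0 + e" if "e > 0" for e
  proof -
    obtain U where U: "open U" "S \<subseteq> U" "U - S \<in> lmeasurable" "emeasure lebesgue (U - S) < ennreal e"
      using sets_lebesgue_outer_open[OF fmeasurableD[OF S] \<open>e > 0\<close>] .
    have US: "?\<mu> (U - S) \<le> e"
      using U(3,4) \<open>e > 0\<close> by (simp add: emeasure_eq_measure2 ennreal_less_iff)
    have "U = S \<union> (U - S)" using U(2) by auto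
    then have Ul: "U \<in> lmeasurable" "?\<mu> U \<le> ?\<mu> S + e"
      using S U(3) US measure_Un_le[of S lebesgue "U - S"] by (metis fmeasurable.Un, simp add: fmeasurableD)
    define K where "K = {(x, r). x \<in> S \<and> 0 < r \<and> ball x r \<subseteq> U \<and> 2 * ?\<mu> (S \<inter> ball x r) \<le> ?\<mu> (ball x r)}"
    have "\<exists>i. i \<in> K \<and> x \<in> ball (fst i) (snd i) \<and> snd i < d" if "x \<in> S" "0 < d" for x d
    proof -
      obtain \<epsilon> where \<epsilon>: "\<epsilon> > 0" "ball x \<epsilon> \<subseteq> U"
        using U(1,2) \<open>x \<in> S\<close> open_contains_ball by (metis subsetD)
      obtain r where r: "0 < r" "r < min d \<epsilon>" "2 * ?\<mu> (S \<inter> ball x r) \<le> ?\<mu> (ball x r)"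
        using dens[OF \<open>x \<in> S\<close>, of "min d \<epsilon>"] \<open>0 < d\<close> \<epsilon>(1) by auto
      have "ball x r \<subseteq> U" using \<epsilon>(2) r(2) subset_ball[of r \<epsilon> x] by auto
      then have "(x, r) \<in> K" using r \<open>x \<in> S\<close> by (simp add: K_def)
      then show ?thesis using r by (intro exI[of _ "(x, r)"]) auto
    qed
    then obtain C where C: "countable C" "C \<subseteq> K"
      "pairwise (\<lambda>i j. disjnt (ball (fst i) (snd i)) (ball (fst j) (snd j))) C"
      "negligible (S - (\<Union>i\<in>C. ball (fst i) (snd i)))"
      by (rule Vitali_covering_theorem_balls[of S K fst snd]) auto
    let ?B = "\<lambda>i. ball (fst i) (snd i)"
    have SB: "S \<inter> ?B i \<in> lmeasurable" for i
      using S by (intro fmeasurable.Int) (auto simp: lmeasurable_ball)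
    \<comment> \<open>A bound uniform over finite subfamilies passes to the countable union by
      \<open>measure_UN_bound\<close>.\<close>
    have fin: "?\<mu> (\<Union>i\<in>F. S \<inter> ?B i) \<le> ?\<mu> U / 2" if F: "F \<subseteq> C" "finite F" for F
    proof -
      have "?\<mu> (\<Union>i\<in>F. S \<inter> ?B i) \<le> (\<Sum>i\<in>F. ?\<mu> (S \<inter> ?B i))"
        using SB by (intro measure_UNION_le F) auto
      also have "\<dots> \<le> (\<Sum>i\<in>F. ?\<mu> (?B i) / 2)"
        using F C(2) by (intro sum_mono) (auto simp: K_def)
      also have "\<dots> = (\<Sum>i\<in>F. ?\<mu> (?B i)) / 2" by (simp add: sum_divide_distrib)
      also have "(\<Sum>i\<in>F. ?\<mu> (?B i)) = ?\<mu> (\<Union>i\<in>F. ?B i)"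
        using pairwise_subset[OF C(3) F(1)] by (intro measure_UNION'[symmetric] F) auto
      also have "\<dots> \<le> ?\<mu> U"
      proof (rule measure_mono_fmeasurable[OF _ _ Ul(1)])
        show "(\<Union>i\<in>F. ?B i) \<subseteq> U"
        proof (rule UN_least)
          fix i assume "i \<in> F"
          then have "i \<in> K" using F(1) C(2) by blast
          then show "?B i \<subseteq> U" by (simp add: K_def case_prod_unfold)
        qed
        show "(\<Union>i\<in>F. ?B i) \<in> sets lebesgue"
          by (intro sets.finite_UN F) simp
      qed
      finally show ?thesis by simp
    qed
    have "?\<mu> (\<Union>i\<in>C. S \<inter> ?B i) \<le> ?\<mu> U / 2"
      by (rule measure_UN_bound[OF C(1) SB fin])
    moreover have "?\<mu> S \<le> ?\<mu> ((\<Union>i\<in>C. S \<inter> ?B i) \<union> (S - (\<Union>i\<in>C. ?B i)))"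
    proof -
      have "S = (\<Union>i\<in>C. S \<inter> ?B i) \<union> (S - (\<Union>i\<in>C. ?B i))" by auto
      from arg_cong[OF this, of ?\<mu>] show ?thesis by (rule eq_refl)
    qed
    moreover have "\<dots> \<le> ?\<mu> (\<Union>i\<in>C. S \<inter> ?B i) + ?\<mu> (S - (\<Union>i\<in>C. ?B i))"
      using SB C(1) negligible_imp_sets[OF C(4)]
      by (intro measure_Un_le sets.countable_UN') (auto dest: fmeasurableD)
    moreover have "?\<mu> (S - (\<Union>i\<in>C. ?B i)) = 0" by (rule negligible_imp_measure0[OF C(4)])
    ultimately show ?thesis using Ul(2) by simp
  qed
  then have "?\<mu> S \<le> 0" by (rule field_le_epsilon)
  then show ?thesis
    using S measure_nonneg[of lebesgue S] by (simp add: negligible_iff_measure0)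
qed

text \<open>Dominated convergence: the indicators converge off the limiting sphere, which is a null
  set, and all balls of the sequence lie in one fixed ball.\<close>

lemma continuous_on_measure_ball_Int:
  fixes z :: "'b::{first_countable_topology, t2_space} \<Rightarrow> 'a::euclidean_space"
  assumes E: "E \<in> sets borel" and z: "continuous_on T z" and r: "continuous_on T r"
  shows "continuous_on T (\<lambda>t. measure lborel (ball (z t) (r t) \<inter> E))"
proof (rule continuous_on_sequentiallyI)
  fix u a assume u: "\<forall>n. u n \<in> T" "a \<in> T" "u \<longlonglongrightarrow> a"
  have zl: "(\<lambda>n. z (u n)) \<longlonglongrightarrow> z a" and rl: "(\<lambda>n. r (u n)) \<longlonglongrightarrow> r a"
    using z r u by (auto simp: continuous_on_sequentially o_def)
  obtain M1 where M1: "\<And>n. dist (z a) (z (u n)) \<le> M1"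
    using convergent_imp_bounded[OF zl] bounded_any_center[of "range (\<lambda>n. z (u n))" "z a"] by auto
  obtain M2 where M2: "\<And>n. \<bar>r (u n)\<bar> \<le> M2"
    using convergent_imp_bounded[OF rl] by (auto simp: bounded_iff)
  define M where "M = M1 + M2"
  have M: "ball (z (u n)) (r (u n)) \<subseteq> ball (z a) M" for n
  proof
    fix x assume "x \<in> ball (z (u n)) (r (u n))"
    then show "x \<in> ball (z a) M"
      using M1[of n] M2[of n] dist_triangle[of "z a" x "z (u n)"] by (auto simp: M_def)
  qed
  let ?f = "\<lambda>n. indicat_real (ball (z (u n)) (r (u n)) \<inter> E)"
  have AE: "AE x in lborel. x \<notin> sphere (z a) (r a)"
  proof (rule AE_not_in)
    show "sphere (z a) (r a) \<in> null_sets lborel"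
      using negligible_sphere[of "z a" "r a"]
      by (auto simp: negligible_iff_null_sets null_sets_completion_iff)
  qed
  have "(\<lambda>n. integral\<^sup>L lborel (?f n)) \<longlonglongrightarrow> integral\<^sup>L lborel (indicat_real (ball (z a) (r a) \<inter> E))"
  proof (rule integral_dominated_convergence)
    show "integrable lborel (indicat_real (ball (z a) M))"
      using emeasure_lborel_ball_finite[of "z a" M] by (intro integrable_real_indicator) auto
    show "AE x in lborel. (\<lambda>n. ?f n x) \<longlonglongrightarrow> indicat_real (ball (z a) (r a) \<inter> E) x"
      using AE
    proof eventually_elim
      case (elim x)
      have lim: "(\<lambda>n. dist (z (u n)) x - r (u n)) \<longlonglongrightarrow> dist (z a) x - r a"
        by (intro tendsto_intros zl rl)
      have "eventually (\<lambda>n. x \<in> ball (z (u n)) (r (u n)) \<longleftrightarrow> x \<in> ball (z a) (r a)) sequentially"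
      proof (cases "dist (z a) x - r a < 0")
        case True
        from order_tendstoD(2)[OF lim this] show ?thesis
          by eventually_elim (use True in auto)
      next
        case False
        then have "0 < dist (z a) x - r a" using elim by auto
        from order_tendstoD(1)[OF lim this] show ?thesis
          by eventually_elim (use False in auto)
      qed
      then have "eventually (\<lambda>n. ?f n x = indicat_real (ball (z a) (r a) \<inter> E) x) sequentially"
        by eventually_elim (simp add: indicator_def)
      then show ?case by (rule tendsto_eventually)
    qed
    show "AE x in lborel. norm (?f n x) \<le> indicat_real (ball (z a) M) x" for n
      using M[of n] by (intro AE_I2) (simp add: indicator_def subset_iff)
  qed (simp_all add: E sets.Int borel_measurable_indicator)
  then show "(\<lambda>n. measure lborel (ball (z (u n)) (r (u n)) \<inter> E)) \<longlonglongrightarrow> measure lborel (ball (z a) (r a) \<inter> E)"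
    using E by simp
qed

section \<open>Distance to the boundary and Whitney balls\<close>

lemma continuous_on_bdry_dist [continuous_intros]:
  "continuous_on T f \<Longrightarrow> continuous_on T (\<lambda>x. bdry_dist \<Omega> (f x))"
  unfolding bdry_dist_def by (intro continuous_intros)

lemma bdry_dist_pos:
  fixes \<Omega> :: "'a::euclidean_space set"
  assumes "open \<Omega>" "bounded \<Omega>" "x \<in> \<Omega>"
  shows "0 < bdry_dist \<Omega> x"
proof -
  \<comment> \<open>\<open>infdist\<close> to the empty set is \<open>0\<close>; boundedness
    excludes \<open>\<Omega> = UNIV\<close> and hence an empty frontier.\<close>
  have "frontier \<Omega> \<noteq> {}"
    using assms not_bounded_UNIV by (auto simp: frontier_eq_empty)
  moreover have "x \<notin> frontier \<Omega>"
    using assms by (auto simp: frontier_def interior_open)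
  ultimately show ?thesis
    unfolding bdry_dist_def by (intro infdist_pos_not_in_closed) auto
qed

text \<open>A ball is connected, so if it meets both \<open>\<Omega>\<close> and its complement it
  contains a frontier point, which would be closer to \<open>x\<close> than the distance to the
  frontier.\<close>

lemma ball_bdry_dist_subset:
  fixes \<Omega> :: "'a::euclidean_space set"
  assumes "x \<in> \<Omega>"
  shows "ball x (bdry_dist \<Omega> x) \<subseteq> \<Omega>"
proof (rule ccontr)
  assume *: "\<not> ball x (bdry_dist \<Omega> x) \<subseteq> \<Omega>"
  then have "0 < bdry_dist \<Omega> x" by (cases "0 < bdry_dist \<Omega> x") (auto simp: ball_empty)
  then have "ball x (bdry_dist \<Omega> x) \<inter> frontier \<Omega> \<noteq> {}"
    using * assms centre_in_ball[of x "bdry_dist \<Omega> x"]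
    by (intro connected_Int_frontier[OF convex_connected[OF convex_ball]]) blast+
  then show False
    using infdist_le[of _ "frontier \<Omega>" x] by (fastforce simp: bdry_dist_def)
qed

lemma bdry_dist_le_diameter:
  fixes \<Omega> :: "'a::euclidean_space set"
  assumes "bounded \<Omega>" "x \<in> \<Omega>"
  shows "bdry_dist \<Omega> x \<le> diameter \<Omega>"
proof -
  have "frontier \<Omega> \<noteq> {}"
    using assms not_bounded_UNIV by (auto simp: frontier_eq_empty)
  then obtain w where w: "w \<in> frontier \<Omega>" by auto
  have "bdry_dist \<Omega> x \<le> dist x w"
    unfolding bdry_dist_def by (rule infdist_le[OF w])
  also have "\<dots> \<le> diameter (closure \<Omega>)"
    using w assms closure_subset[of \<Omega>]
    by (intro diameter_bounded_bound bounded_closure) (auto simp: frontier_def)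
  finally show ?thesis using assms by (simp add: diameter_closure)
qed

lemma bdry_dist_lipschitz: "bdry_dist \<Omega> x \<le> bdry_dist \<Omega> y + dist x y"
  unfolding bdry_dist_def by (rule infdist_triangle)

text \<open>Along the John curve the density of \<open>E\<close> in Whitney balls passes from at least to at most
  one half, unless it already drops to one half in a smaller ball centred at the starting point.\<close>

lemma distance_John_half_density_ball:
  fixes \<Omega> E :: "'a::euclidean_space set"
  assumes John: "distance_John_domain s C xJ \<Omega>" and c: "0 < c"
    and E: "E \<in> sets borel"
    and central: "2 * measure lborel (ball xJ (c * bdry_dist \<Omega> xJ) \<inter> E)
      \<le> measure lborel (ball xJ (c * bdry_dist \<Omega> xJ))"
    and x: "x \<in> \<Omega>" and r0: "0 < r0" "r0 \<le> c * bdry_dist \<Omega> x"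
    and dense: "measure lborel (ball x r0) \<le> 2 * measure lborel (ball x r0 \<inter> E)"
  obtains z r where "z \<in> \<Omega>" "0 < r" "r \<le> c * bdry_dist \<Omega> z"
    "2 * measure lborel (ball z r \<inter> E) = measure lborel (ball z r)"
    "norm (z - x) powr s \<le> C / c * r"
proof -
  \<comment> \<open>The sign of \<open>g\<close> tells whether \<open>E\<close> fills more or less
    than half of the ball, so zeros of \<open>g\<close> are the balls sought.\<close>
  define g where "g z r = 2 * measure lborel (ball z r \<inter> E) - measure lborel (ball z r)" for z r
  have cont: "continuous_on T (\<lambda>t. g (z t) (r t))"
    if "continuous_on T z" "continuous_on T r" for T and z :: "real \<Rightarrow> 'a" and r
    using continuous_on_measure_ball_Int[OF E that] continuous_on_measure_ball_Int[of UNIV T z r] that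
    unfolding g_def by (intro continuous_intros) auto
  have C: "1 \<le> C" using John by (simp add: distance_John_domain_def)
  show thesis
  proof (cases "g x (c * bdry_dist \<Omega> x) \<le> 0")
    case True
    have "\<exists>r. r0 \<le> r \<and> r \<le> c * bdry_dist \<Omega> x \<and> g x r = 0"
      using True dense r0 by (intro IVT2' cont continuous_intros) (auto simp: g_def)
    then obtain r where "r0 \<le> r" "r \<le> c * bdry_dist \<Omega> x" "g x r = 0" by auto
    \<comment> \<open>With \<open>z = x\<close> the distance estimate has left side
      \<open>0 powr s = 0\<close>.\<close>
    then show thesis
      using x r0 c C by (intro that[of x r]) (auto simp: g_def)
  next
    case False
    obtain \<gamma> where \<gamma>: "path \<gamma>" "path_image \<gamma> \<subseteq> \<Omega>" "\<gamma> 0 = x" "\<gamma> 1 = xJ"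
      and cig: "\<And>t. t \<in> {0..1} \<Longrightarrow> C * bdry_dist \<Omega> (\<gamma> t) > norm (\<gamma> t - x) powr s"
      using John x unfolding distance_John_domain_def by blast
    have "\<exists>t. 0 \<le> t \<and> t \<le> 1 \<and> g (\<gamma> t) (c * bdry_dist \<Omega> (\<gamma> t)) = 0"
      using False central \<gamma>
      by (intro IVT2' cont continuous_intros) (auto simp: g_def path_def)
    then obtain t where t: "t \<in> {0..1}" "g (\<gamma> t) (c * bdry_dist \<Omega> (\<gamma> t)) = 0" by auto
    have z: "\<gamma> t \<in> \<Omega>" using \<gamma>(2) t(1) by (auto simp: path_image_def)
    have "0 < bdry_dist \<Omega> (\<gamma> t)"
      using z John by (intro bdry_dist_pos) (auto simp: distance_John_domain_def)
    \<comment> \<open>For \<open>r = c * bdry_dist \<Omega> (\<gamma> t)\<close> the distance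
      estimate is exactly the John condition at \<open>t\<close>.\<close>
    then show thesis
      using z t(2) c cig[OF t(1)]
      by (intro that[of "\<gamma> t" "c * bdry_dist \<Omega> (\<gamma> t)"]) (auto simp: g_def)
  qed
qed

subsection \<open>The relative isoperimetric inequality\<close>

text \<open>The first component is the point whose boundary distance sets the truncation radius, so
  the set is in general not symmetric.\<close>

definition whitney_pairs :: "real \<Rightarrow> 'a::euclidean_space set \<Rightarrow> ('a \<times> 'a) set" where
  "whitney_pairs \<tau> \<Omega> = {(y, x). y \<in> \<Omega> \<and> x \<in> \<Omega> \<and> norm (x - y) < \<tau> * bdry_dist \<Omega> y}"

text \<open>This is the truncated seminorm of the indicator function of \<open>E\<close>, whose
  increments are \<open>1\<close> on the pairs cut by \<open>E\<close> and \<open>0\<close>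
  elsewhere.\<close>

definition fractional_perimeter :: "real \<Rightarrow> real \<Rightarrow> 'a::euclidean_space set \<Rightarrow> 'a set \<Rightarrow> ennreal" where
  "fractional_perimeter \<delta> \<tau> \<Omega> E =
     kernel_integral (real DIM('a) + \<delta>) {z \<in> whitney_pairs \<tau> \<Omega>. (fst z \<in> E) \<noteq> (snd z \<in> E)}"

lemma whitney_pairs_borel [measurable]:
  fixes \<Omega> :: "'a::euclidean_space set"
  assumes [measurable]: "\<Omega> \<in> sets borel"
  shows "whitney_pairs \<tau> \<Omega> \<in> sets borel"
proof -
  have [measurable]: "bdry_dist \<Omega> \<in> borel_measurable borel"
    by (intro borel_measurable_continuous_onI continuous_intros)
  have "whitney_pairs \<tau> \<Omega> = {z \<in> space (borel \<Otimes>\<^sub>M borel).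
      fst z \<in> \<Omega> \<and> snd z \<in> \<Omega> \<and> norm (snd z - fst z) < \<tau> * bdry_dist \<Omega> (fst z)}"
    by (auto simp: whitney_pairs_def space_pair_measure)
  also have "\<dots> \<in> sets (borel \<Otimes>\<^sub>M borel)"
    by measurable
  finally show ?thesis by (simp only: borel_prod)
qed

lemma cut_pairs_borel [measurable]:
  fixes E :: "'a::euclidean_space set"
  assumes [measurable]: "E \<in> sets borel" "A \<in> sets borel"
  shows "{z \<in> A. (fst z \<in> E) \<noteq> (snd z \<in> E)} \<in> sets (borel :: ('a \<times> 'a) measure)"
proof -
  have "{z \<in> A. (fst z \<in> E) \<noteq> (snd z \<in> E)} =
      A \<inter> {z \<in> space (borel \<Otimes>\<^sub>M borel). (fst z \<in> E) \<noteq> (snd z \<in> E)}"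
    by (auto simp: space_pair_measure)
  also have "{z \<in> space (borel \<Otimes>\<^sub>M borel). (fst z \<in> E) \<noteq> (snd z \<in> E)} \<in> sets (borel \<Otimes>\<^sub>M borel)"
    by measurable
  then have "A \<inter> {z \<in> space (borel \<Otimes>\<^sub>M borel). (fst z \<in> E) \<noteq> (snd z \<in> E)} \<in> sets borel"
    by (intro sets.Int assms) (simp only: borel_prod)
  finally show ?thesis .
qed

text \<open>Seen as a measure with a density, the kernel integral inherits additivity over disjoint
  sets of pairs.\<close>

lemma kernel_integral_eq_emeasure:
  assumes "A \<in> sets (borel :: ('a::euclidean_space \<times> 'a) measure)"
  shows "kernel_integral p A = emeasure (density lborel (\<lambda>z. ennreal (norm (fst z - snd z) powr (-p)))) A"
  unfolding kernel_integral_def using assms by (subst emeasure_density) auto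

lemma sum_kernel_integral_le:
  assumes "finite F" and A: "A \<in> sets (borel :: ('a::euclidean_space \<times> 'a) measure)"
    and S: "\<And>i. i \<in> F \<Longrightarrow> S i \<in> sets borel" "\<And>i. i \<in> F \<Longrightarrow> S i \<subseteq> A"
    and disj: "disjoint_family_on S F"
  shows "(\<Sum>i\<in>F. kernel_integral p (S i)) \<le> kernel_integral p A"
proof -
  let ?M = "density lborel (\<lambda>z :: 'a \<times> 'a. ennreal (norm (fst z - snd z) powr (-p)))"
  have "(\<Sum>i\<in>F. kernel_integral p (S i)) = (\<Sum>i\<in>F. emeasure ?M (S i))"
    using S by (intro sum.cong kernel_integral_eq_emeasure) auto
  also have "\<dots> = emeasure ?M (\<Union>i\<in>F. S i)"
    using S by (intro sum_emeasure disj assms(1)) auto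
  also have "\<dots> \<le> emeasure ?M A"
    using A S by (intro emeasure_mono) auto
  finally show ?thesis by (simp add: kernel_integral_eq_emeasure[OF A])
qed

text \<open>Here the radius factor \<open>\<tau> / 4\<close> pays off: points of the ball are less
  than \<open>2 * r\<close>, hence less than half of \<open>\<tau> * bdry_dist \<Omega> z\<close>,
  apart, while \<open>r\<close> is at most a quarter of the boundary distance of \<open>z\<close>,
  so every point of the ball keeps three quarters of it.\<close>

lemma separated_pairs_subset_whitney_pairs:
  fixes \<Omega> :: "'a::euclidean_space set"
  assumes \<tau>: "0 < \<tau>" "\<tau> < 1" and z: "z \<in> \<Omega>" "r \<le> \<tau> / 4 * bdry_dist \<Omega> z"
  shows "separated_pairs (ball z r) E \<rho> \<subseteq> {w \<in> whitney_pairs \<tau> \<Omega>. (fst w \<in> E) \<noteq> (snd w \<in> E)}"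
proof clarify
  fix y x assume yx: "(y, x) \<in> separated_pairs (ball z r) E \<rho>"
  then have yz: "dist z y < r" and xz: "dist z x < r" and sep: "(y \<in> E) \<noteq> (x \<in> E)"
    by (auto simp: separated_pairs_def)
  let ?d = "bdry_dist \<Omega>"
  have d0: "0 \<le> ?d z" by (simp add: bdry_dist_def infdist_nonneg)
  then have "\<tau> * ?d z \<le> 1 * ?d z" using \<tau> by (intro mult_right_mono) auto
  then have r: "r \<le> ?d z / 4" using z(2) by simp
  have "ball z r \<subseteq> \<Omega>"
    using ball_bdry_dist_subset[OF z(1)] subset_ball[of r "?d z" z] r d0 by auto
  moreover have "norm (x - y) < \<tau> * ?d y"
  proof -
    have "norm (x - y) < 2 * r"
      using yz xz dist_triangle2[of x y z] by (simp add: dist_norm[symmetric] dist_commute)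
    moreover have "3/4 * ?d z \<le> ?d y"
      using bdry_dist_lipschitz[of \<Omega> z y] yz r by simp
    then have "\<tau> * (3/4 * ?d z) \<le> \<tau> * ?d y" using \<tau> by (intro mult_left_mono) auto
    moreover have "2 * r \<le> \<tau> * (?d z / 2)" using z(2) by simp
    moreover have "\<tau> * (?d z / 2) \<le> \<tau> * (3/4 * ?d z)" using \<tau> d0 by (intro mult_left_mono) auto
    ultimately show ?thesis by linarith
  qed
  ultimately show "(y, x) \<in> whitney_pairs \<tau> \<Omega> \<and> (fst (y, x) \<in> E) \<noteq> (snd (y, x) \<in> E)"
    using yz xz sep by (auto simp: whitney_pairs_def)
qed

text \<open>The first factor is the volume of the enlarged Vitali balls per unit radius of the Whitney
  ball, the second one the inverse of the constant in
  \<open>kernel_integral_separated_pairs_ge\<close>.\<close>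

definition isoperimetric_const :: "nat \<Rightarrow> real \<Rightarrow> real \<Rightarrow> real \<Rightarrow> real \<Rightarrow> real" where
  "isoperimetric_const n \<tau> s C D =
     max 1 (unit_ball_vol n * (5 * ((C / (\<tau> / 4)) powr (1 / s) + D powr (1 - 1 / s))) ^ n)
       * (2 ^ (n + 4) / (unit_ball_vol n)\<^sup>2)"

lemma isoperimetric_const_pos: "0 < isoperimetric_const n \<tau> s C D"
  unfolding isoperimetric_const_def by (intro mult_pos_pos divide_pos_pos zero_less_power) auto

text \<open>Vitali's covering bounds \<open>|E|\<close> by a multiple of the sum of
  \<open>r powr (n / s)\<close>, and the perimeter controls the sum of
  \<open>r powr (n - \<delta>)\<close>. As \<open>\<theta> \<le> 1\<close>, the power
  \<open>1 / \<theta>\<close> passes from one sum to the other. A finite \<open>P\<close> keeps all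
  powers within the reals.\<close>

lemma distance_John_isoperimetric_finite:
  fixes \<Omega> E :: "'a::euclidean_space set" and \<delta> \<tau> s C D P :: real
  defines "n \<equiv> DIM('a)"
  defines "\<theta> \<equiv> s * (n - \<delta>) / n"
  assumes John: "distance_John_domain s C xJ \<Omega>" and D: "diameter \<Omega> = D"
    and \<tau>: "0 < \<tau>" "\<tau> < 1" and \<delta>: "0 < \<delta>" "\<delta> < 1" and \<theta>: "\<theta> \<le> 1"
    and E: "E \<in> sets borel" "E \<subseteq> \<Omega>"
    and central: "2 * measure lborel (ball xJ (\<tau> / 4 * bdry_dist \<Omega> xJ) \<inter> E)
      \<le> measure lborel (ball xJ (\<tau> / 4 * bdry_dist \<Omega> xJ))"
    and P: "fractional_perimeter \<delta> \<tau> \<Omega> E = ennreal P" "0 \<le> P"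
  shows "measure lborel E powr \<theta> \<le> isoperimetric_const n \<tau> s C D * (1 - \<delta>) * P"
proof -
  define c where "c = \<tau> / 4"
  define \<omega> where "\<omega> = unit_ball_vol n"
  \<comment> \<open>\<open>K\<close> is chosen so that the ball around \<open>z x\<close> lies in
    the ball of radius \<open>K * r x powr (1 / s)\<close> around \<open>x\<close>: the first
    summand bounds the distance of the centres, the second one the radius, by
    \<open>r x \<le> D\<close>.\<close>
  define K where "K = (C / c) powr (1 / s) + D powr (1 - 1 / s)"
  define A where "A = \<omega> * (5 * K) ^ n"
  define M where "M = 2 ^ (n + 4) / \<omega>\<^sup>2"
  define m where "m = M * (1 - \<delta>) * P"
  have \<Omega>: "open \<Omega>" "bounded \<Omega>" and s: "1 \<le> s" and C: "1 \<le> C"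
    using John by (auto simp: distance_John_domain_def)
  have n: "1 \<le> n" by (simp add: n_def Suc_le_eq)
  have c: "0 < c" using \<tau> by (simp add: c_def)
  have \<omega>: "0 < \<omega>" by (simp add: \<omega>_def)
  have M: "0 < M" unfolding M_def using \<omega> by (intro divide_pos_pos) auto
  have m: "0 \<le> m" unfolding m_def using M \<delta> P by simp
  have K: "0 < K" unfolding K_def using C c by (intro add_pos_nonneg) auto
  have A: "0 \<le> A" unfolding A_def using \<omega> K by simp
  have nd: "0 < real n - \<delta>" using n \<delta> by simp
  have \<theta>0: "0 < \<theta>" unfolding \<theta>_def using s nd n by simp
  have E_lm: "E \<in> lmeasurable"
    using E \<Omega>(2) by (auto intro!: bounded_set_imp_lmeasurable bounded_subset[OF \<Omega>(2)])

  \<comment> \<open>Points of \<open>E\<close> without a ball of small radius that is more than half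
    filled. They offer no starting radius \<open>r0\<close>, but form a null set.\<close>
  define Z where "Z = {x \<in> E. \<forall>r. 0 < r \<and> r < c * bdry_dist \<Omega> x \<longrightarrow>
    2 * measure lborel (ball x r \<inter> E) \<le> measure lborel (ball x r)}"
  \<comment> \<open>For fixed \<open>r\<close> the condition is closed, because the measure of a
    ball intersected with \<open>E\<close> is continuous in the centre; this makes \<open>Z\<close>
    measurable. Intersecting with \<open>UNIV\<close> lets the same continuity lemma treat the
    volume of the ball.\<close>
  have "closed {x. \<forall>r. 0 < r \<and> r < c * bdry_dist \<Omega> x \<longrightarrow>
    2 * measure lborel (ball x r \<inter> E) \<le> measure lborel (ball x r)}" (is "closed ?Z")
  proof -
    have "?Z = (\<Inter>r\<in>{0<..}. {x. c * bdry_dist \<Omega> x \<le> r} \<union>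
        {x. 2 * measure lborel (ball x r \<inter> E) \<le> measure lborel (ball x r \<inter> UNIV)})"
      by (auto simp: not_less[symmetric])
    also have "closed \<dots>"
      using E(1) by (intro closed_INT ballI closed_Un closed_Collect_le continuous_intros
        continuous_on_measure_ball_Int) auto
    finally show ?thesis .
  qed
  moreover have "Z = E \<inter> ?Z" by (auto simp: Z_def)
  ultimately have Z_lm: "Z \<in> lmeasurable"
    using E_lm by (simp add: fmeasurable_Int_fmeasurable sets_completionI_sets)
  have "negligible Z"
  proof (rule negligible_if_density_le_half[OF Z_lm])
    fix x and d :: real assume x: "x \<in> Z" "0 < d"
    then have d: "0 < c * bdry_dist \<Omega> x"
      using c bdry_dist_pos[OF \<Omega>, of x] E(2) by (auto simp: Z_def)
    define r where "r = min d (c * bdry_dist \<Omega> x) / 2"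
    have r: "0 < r" "r < d" "r < c * bdry_dist \<Omega> x" using d x(2) by (auto simp: r_def)
    have "2 * measure lebesgue (Z \<inter> ball x r) \<le> 2 * measure lebesgue (ball x r \<inter> E)"
      using Z_lm E_lm by (intro mult_left_mono measure_mono_fmeasurable fmeasurable.Int)
        (auto simp: Z_def fmeasurableD sets.Int)
    also have "\<dots> \<le> measure lebesgue (ball x r)"
      using x r E(1) by (auto simp: Z_def)
    finally show "\<exists>r. 0 < r \<and> r < d \<and> 2 * measure lebesgue (Z \<inter> ball x r) \<le> measure lebesgue (ball x r)"
      using r by blast
  qed

  have "\<exists>z r. z \<in> \<Omega> \<and> 0 < r \<and> r \<le> c * bdry_dist \<Omega> z \<and>
      2 * measure lborel (ball z r \<inter> E) = measure lborel (ball z r) \<and>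
      norm (z - x) powr s \<le> C / c * r" if x: "x \<in> E - Z" for x
  proof -
    from x obtain r0 where r0: "0 < r0" "r0 < c * bdry_dist \<Omega> x"
      "2 * measure lborel (ball x r0 \<inter> E) > measure lborel (ball x r0)"
      by (auto simp: Z_def not_le)
    show ?thesis
      using distance_John_half_density_ball[OF John c E(1), of x r0] central x E(2) r0
      unfolding c_def by (smt (verit, best) DiffD1 subsetD)
  qed
  then obtain z r where zr: "\<And>x. x \<in> E - Z \<Longrightarrow> z x \<in> \<Omega>" "\<And>x. x \<in> E - Z \<Longrightarrow> 0 < r x"
    "\<And>x. x \<in> E - Z \<Longrightarrow> r x \<le> c * bdry_dist \<Omega> (z x)"
    "\<And>x. x \<in> E - Z \<Longrightarrow> 2 * measure lborel (ball (z x) (r x) \<inter> E) = measure lborel (ball (z x) (r x))"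
    "\<And>x. x \<in> E - Z \<Longrightarrow> norm (z x - x) powr s \<le> C / c * r x"
    by metis
  define R where "R x = K * r x powr (1 / s)" for x
  have rD: "r x \<le> D" if "x \<in> E - Z" for x
  proof -
    have "r x \<le> c * bdry_dist \<Omega> (z x)" by (rule zr(3)[OF that])
    also have "\<dots> \<le> 1 * bdry_dist \<Omega> (z x)"
      using \<tau> by (intro mult_right_mono) (auto simp: c_def bdry_dist_def infdist_nonneg)
    also have "\<dots> \<le> D"
      using bdry_dist_le_diameter[OF \<Omega>(2) zr(1)[OF that]] D by simp
    finally show ?thesis .
  qed
  have sub: "ball (z x) (r x) \<subseteq> cball x (R x)" if x: "x \<in> E - Z" for x
  proof
    fix y assume "y \<in> ball (z x) (r x)"
    then have "dist x y \<le> norm (z x - x) + r x"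
      using dist_triangle[of x y "z x"] by (simp add: dist_norm norm_minus_commute)
    moreover have "norm (z x - x) \<le> (C / c) powr (1 / s) * r x powr (1 / s)"
    proof -
      have "norm (z x - x) = (norm (z x - x) powr s) powr (1 / s)"
        using s by (simp add: powr_powr)
      also have "\<dots> \<le> (C / c * r x) powr (1 / s)"
        using zr(5)[OF x] s by (intro powr_mono2) auto
      also have "\<dots> = (C / c) powr (1 / s) * r x powr (1 / s)"
        by (rule powr_mult)
      finally show ?thesis .
    qed
    moreover have "r x \<le> D powr (1 - 1 / s) * r x powr (1 / s)"
    proof -
      have "r x = r x powr (1 - 1 / s) * r x powr (1 / s)"
        using zr(2)[OF x] by (simp add: powr_add[symmetric])
      also have "\<dots> \<le> D powr (1 - 1 / s) * r x powr (1 / s)"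
        using rD[OF x] zr(2)[OF x] s by (intro mult_right_mono powr_mono2) auto
      finally show ?thesis .
    qed
    ultimately show "y \<in> cball x (R x)" by (simp add: R_def K_def algebra_simps)
  qed
  \<comment> \<open>Vitali's covering lemma asks for bounded radii.\<close>
  have R: "0 < R x \<and> R x \<le> K * D powr (1 / s)" if x: "x \<in> E - Z" for x
    using zr(2)[OF x] rD[OF x] K s unfolding R_def by (auto intro!: mult_left_mono powr_mono2)
  obtain I where I: "countable I" "I \<subseteq> E - Z" "pairwise (\<lambda>i j. disjnt (cball i (R i)) (cball j (R j))) I"
    "E - Z \<subseteq> (\<Union>i\<in>I. cball i (5 * R i))"
  proof (rule Vitali_covering_lemma_cballs[where S = "E - Z" and K = "E - Z" and a = "\<lambda>x. x" and r = R
        and B = "K * D powr (1 / s)"])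
    show "E - Z \<subseteq> (\<Union>i\<in>E - Z. cball i (R i))"
      using R by (meson UN_I centre_in_cball less_imp_le subsetI)
  qed (use R in blast)+

  define S where "S i = separated_pairs (ball (z i) (r i)) E (2 * r i)" for i
  define W where "W = {w \<in> whitney_pairs \<tau> \<Omega>. (fst w \<in> E) \<noteq> (snd w \<in> E)}"
  have W: "W \<in> sets borel"
    unfolding W_def using E(1) \<Omega>(1) by measurable
  \<comment> \<open>The half-filled balls lie in disjoint Vitali balls, so the sets
    \<open>S i\<close> are disjoint parts of \<open>W\<close>; each contributes at least
    \<open>r i powr (n - \<delta>) / M\<close> to \<open>(1 - \<delta>) * P\<close>.\<close>
  have sum_r: "(\<Sum>i\<in>F. r i powr (n - \<delta>)) \<le> m" if F: "finite F" "F \<subseteq> I" for F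
  proof -
    have i: "i \<in> E - Z" if "i \<in> F" for i using that F I by auto
    have "ennreal (\<Sum>i\<in>F. 1 / M * r i powr (n - \<delta>)) = (\<Sum>i\<in>F. ennreal (1 / M * r i powr (n - \<delta>)))"
      using M by (intro sum_ennreal[symmetric]) auto
    also have "\<dots> \<le> (\<Sum>i\<in>F. ennreal (1 - \<delta>) * kernel_integral (n + \<delta>) (S i))"
    proof (rule sum_mono)
      fix j assume "j \<in> F"
      from kernel_integral_separated_pairs_ge[OF zr(2)[OF i[OF this]] \<delta> E(1) zr(4)[OF i[OF this]]]
      show "ennreal (1 / M * r j powr (n - \<delta>)) \<le> ennreal (1 - \<delta>) * kernel_integral (n + \<delta>) (S j)"
        by (simp add: M_def S_def n_def \<omega>_def)
    qed
    also have "\<dots> = ennreal (1 - \<delta>) * (\<Sum>i\<in>F. kernel_integral (n + \<delta>) (S i))"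
      by (simp add: sum_distrib_left)
    also have "\<dots> \<le> ennreal (1 - \<delta>) * kernel_integral (n + \<delta>) W"
    proof (intro mult_left_mono sum_kernel_integral_le F W)
      show "S i \<in> sets borel" for i unfolding S_def using E(1) by measurable
      show "S j \<subseteq> W" if "j \<in> F" for j
        unfolding S_def W_def
        by (intro separated_pairs_subset_whitney_pairs \<tau> zr(1) i that zr(3)[OF i[OF that], unfolded c_def])
      show "disjoint_family_on S F"
        unfolding disjoint_family_on_def
      proof (intro ballI impI)
        fix j k assume jk: "j \<in> F" "k \<in> F" "j \<noteq> k"
        then have "disjnt (cball j (R j)) (cball k (R k))"
          using I(3) F(2) by (auto simp: pairwise_def)
        then show "S j \<inter> S k = {}"
          using sub[OF i[OF jk(1)]] sub[OF i[OF jk(2)]] unfolding S_def separated_pairs_def disjnt_def by blast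
      qed
    qed simp
    also have "\<dots> = ennreal ((1 - \<delta>) * P)"
      using P \<delta> by (simp add: W_def fractional_perimeter_def n_def ennreal_mult)
    finally have "(\<Sum>i\<in>F. 1 / M * r i powr (n - \<delta>)) \<le> (1 - \<delta>) * P"
      using \<delta> P by (subst (asm) ennreal_le_iff) auto
    then have "M * (\<Sum>i\<in>F. 1 / M * r i powr (n - \<delta>)) \<le> M * ((1 - \<delta>) * P)"
      using M by (intro mult_left_mono) auto
    then show ?thesis using M by (simp add: sum_distrib_left m_def mult.assoc)
  qed

  \<comment> \<open>As \<open>n / s = (n - \<delta>) / \<theta>\<close>, the volumes are multiples
    of the powers \<open>1 / \<theta> \<ge> 1\<close> of the summands in \<open>sum_r\<close>. One
    factor stays in the sum, and the rest is at most \<open>m powr (1 / \<theta> - 1)\<close>, since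
    each summand is at most \<open>m\<close>.\<close>
  have bound: "measure lebesgue (\<Union>i\<in>F. cball i (5 * R i)) \<le> A * m powr (1 / \<theta>)"
    if F: "F \<subseteq> I" "finite F" for F
  proof -
    have i: "i \<in> E - Z" if "i \<in> F" for i using that F I by auto
    have "measure lebesgue (\<Union>i\<in>F. cball i (5 * R i)) \<le> (\<Sum>i\<in>F. measure lebesgue (cball i (5 * R i)))"
      by (intro measure_UNION_le F) simp
    also have "\<dots> \<le> (\<Sum>i\<in>F. A * (r i powr (n - \<delta>) * m powr (1 / \<theta> - 1)))"
    proof (rule sum_mono)
      fix j assume j: "j \<in> F"
      have rj: "0 < r j" by (rule zr(2)[OF i[OF j]])
      have "measure lebesgue (cball j (5 * R j)) = \<omega> * (5 * R j) ^ n"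
        using R[OF i[OF j]] by (simp add: content_cball \<omega>_def n_def)
      also have "\<dots> = A * r j powr (n / s)"
      proof -
        have "(r j powr (1 / s)) ^ n = r j powr (n / s)"
          using rj by (simp add: powr_power)
        then show ?thesis by (simp add: R_def A_def power_mult_distrib)
      qed
      also have "r j powr (n / s) = (r j powr (n - \<delta>)) powr (1 / \<theta>)"
        using nd s by (simp add: powr_powr \<theta>_def)
      also have "\<dots> = r j powr (n - \<delta>) * (r j powr (n - \<delta>)) powr (1 / \<theta> - 1)"
        by (subst powr_mult_base) auto
      also have "(r j powr (n - \<delta>)) powr (1 / \<theta> - 1) \<le> m powr (1 / \<theta> - 1)"
        using sum_r[of "{j}"] F j \<theta> \<theta>0 by (intro powr_mono2) auto
      finally show "measure lebesgue (cball j (5 * R j)) \<le> A * (r j powr (n - \<delta>) * m powr (1 / \<theta> - 1))"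
        using A by (simp add: mult_left_mono)
    qed
    also have "\<dots> = A * ((\<Sum>i\<in>F. r i powr (n - \<delta>)) * m powr (1 / \<theta> - 1))"
      by (simp add: sum_distrib_left sum_distrib_right)
    also have "\<dots> \<le> A * (m * m powr (1 / \<theta> - 1))"
      using A sum_r F by (intro mult_left_mono mult_right_mono) auto
    also have "m * m powr (1 / \<theta> - 1) = m powr (1 / \<theta>)"
      using m by (subst powr_mult_base) auto
    finally show ?thesis .
  qed
  have "measure lborel E \<le> A * m powr (1 / \<theta>)"
  proof -
    let ?U = "\<Union>i\<in>I. cball i (5 * R i)"
    have U: "?U \<in> lmeasurable" "measure lebesgue ?U \<le> A * m powr (1 / \<theta>)"
      by (rule fmeasurable_UN_bound[OF I(1) _ bound], simp, assumption+)
         (rule measure_UN_bound[OF I(1) _ bound], simp, assumption+)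
    have "measure lebesgue E \<le> measure lebesgue (Z \<union> ?U)"
      using E_lm Z_lm U I(4) by (intro measure_mono_fmeasurable) auto
    also have "\<dots> \<le> measure lebesgue Z + measure lebesgue ?U"
      using Z_lm U by (intro measure_Un_le) auto
    also have "measure lebesgue Z = 0" by (rule negligible_imp_measure0[OF \<open>negligible Z\<close>])
    finally show ?thesis using U E(1) by simp
  qed
  then have "measure lborel E powr \<theta> \<le> (A * m powr (1 / \<theta>)) powr \<theta>"
    using \<theta>0 by (intro powr_mono2) auto
  also have "\<dots> = A powr \<theta> * m"
    using A m \<theta>0 by (simp add: powr_mult powr_powr)
  finally have le: "measure lborel E powr \<theta> \<le> A powr \<theta> * m" .
  \<comment> \<open>This frees the constant from \<open>\<theta>\<close>, and so from
    \<open>\<delta>\<close>.\<close>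
  have "A powr \<theta> \<le> max 1 A"
  proof (cases "A \<le> 1")
    case True
    then show ?thesis using A \<theta>0 powr_mono2[of \<theta> A 1] by simp
  next
    case False
    then show ?thesis using \<theta> powr_mono[of \<theta> 1 A] by simp
  qed
  with le m have "measure lborel E powr \<theta> \<le> max 1 A * m"
    by (meson mult_right_mono order_trans)
  then show ?thesis
    by (simp add: isoperimetric_const_def A_def K_def \<omega>_def m_def M_def c_def mult_ac)
qed

lemma distance_John_isoperimetric:
  fixes \<Omega> E :: "'a::euclidean_space set" and \<delta> \<tau> s C D :: real
  assumes "distance_John_domain s C xJ \<Omega>" "diameter \<Omega> = D"
    and "0 < \<tau>" "\<tau> < 1" "0 < \<delta>" "\<delta> < 1" "s * (DIM('a) - \<delta>) / DIM('a) \<le> 1"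
    and "E \<in> sets borel" "E \<subseteq> \<Omega>"
    and "2 * measure lborel (ball xJ (\<tau> / 4 * bdry_dist \<Omega> xJ) \<inter> E)
      \<le> measure lborel (ball xJ (\<tau> / 4 * bdry_dist \<Omega> xJ))"
  shows "ennreal (measure lborel E powr (s * (DIM('a) - \<delta>) / DIM('a)))
    \<le> ennreal (isoperimetric_const DIM('a) \<tau> s C D * (1 - \<delta>)) * fractional_perimeter \<delta> \<tau> \<Omega> E"
proof (cases "fractional_perimeter \<delta> \<tau> \<Omega> E")
  case (real P)
  then show ?thesis
    using distance_John_isoperimetric_finite[OF assms real(2,1)] isoperimetric_const_pos[of "DIM('a)" \<tau> s C D] assms(6)
    by (simp add: ennreal_mult[symmetric] ennreal_leI)
next
  case top
  then show ?thesis
    using isoperimetric_const_pos[of "DIM('a)" \<tau> s C D] assms(6) by (simp add: ennreal_mult_top)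
qed

subsection \<open>From level sets to functions\<close>

text \<open>The levels \<open>t\<close> whose superlevel set cuts a given pair form the half-open
  interval between the two values of \<open>u\<close>, whose length is their difference; Tonelli's
  theorem exchanges \<open>t\<close> and the pair. Both points of a Whitney pair lie in
  \<open>\<Omega>\<close>, so restricting the level sets to \<open>\<Omega>\<close> is
  harmless.\<close>

lemma fractional_coarea:
  fixes u :: "'a::euclidean_space \<Rightarrow> real"
  assumes [measurable]: "u \<in> borel_measurable borel" "\<Omega> \<in> sets borel"
  shows borel_measurable_fractional_perimeter:
      "(\<lambda>t. fractional_perimeter \<delta> \<tau> \<Omega> {x \<in> \<Omega>. t < u x}) \<in> borel_measurable borel" (is ?meas)
    and nn_integral_fractional_perimeter:
      "(\<integral>\<^sup>+t. fractional_perimeter \<delta> \<tau> \<Omega> {x \<in> \<Omega>. t < u x} \<partial>lborel)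
    = (\<integral>\<^sup>+z. ennreal (\<bar>u (fst z) - u (snd z)\<bar> / norm (fst z - snd z) powr (real DIM('a) + \<delta>))
         * indicator (whitney_pairs \<tau> \<Omega>) z \<partial>lborel)" (is ?coarea)
proof -
  let ?W = "whitney_pairs \<tau> \<Omega>"
  define p where "p = real DIM('a) + \<delta>"
  define F where "F t z = ennreal (norm (fst z - snd z) powr (-p)) * (indicator ?W z *
    (if min (u (fst z)) (u (snd z)) \<le> t \<and> t < max (u (fst z)) (u (snd z)) then 1 else 0))" for t :: real and z :: "'a \<times> 'a"
  have [measurable]: "case_prod F \<in> borel_measurable (lborel \<Otimes>\<^sub>M lborel)"
    unfolding F_def by measurable
  have eq: "fractional_perimeter \<delta> \<tau> \<Omega> {x \<in> \<Omega>. t < u x} = (\<integral>\<^sup>+z. F t z \<partial>lborel)" for t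
    unfolding fractional_perimeter_def kernel_integral_def
  proof (intro nn_integral_cong)
    fix z :: "'a \<times> 'a"
    show "ennreal (norm (fst z - snd z) powr - (real DIM('a) + \<delta>)) *
        indicator {z \<in> ?W. (fst z \<in> {x \<in> \<Omega>. t < u x}) \<noteq> (snd z \<in> {x \<in> \<Omega>. t < u x})} z = F t z"
      by (auto simp: F_def p_def indicator_def whitney_pairs_def min_le_iff_disj less_max_iff_disj)
  qed
  have "(\<lambda>t. \<integral>\<^sup>+z. F t z \<partial>lborel) \<in> borel_measurable lborel"
    by (rule lborel.borel_measurable_nn_integral) measurable
  then show ?meas by (simp add: eq)
  have "(\<integral>\<^sup>+t. fractional_perimeter \<delta> \<tau> \<Omega> {x \<in> \<Omega>. t < u x} \<partial>lborel) = (\<integral>\<^sup>+t. (\<integral>\<^sup>+z. F t z \<partial>lborel) \<partial>lborel)"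
    by (simp only: eq)
  also have "\<dots> = (\<integral>\<^sup>+z. (\<integral>\<^sup>+t. F t z \<partial>lborel) \<partial>lborel)"
    by (rule lborel_pair.Fubini') (simp add: case_prod_unfold)
  also have "\<dots> = (\<integral>\<^sup>+z. ennreal (\<bar>u (fst z) - u (snd z)\<bar> / norm (fst z - snd z) powr p) * indicator ?W z \<partial>lborel)"
  proof (intro nn_integral_cong)
    fix z :: "'a \<times> 'a"
    let ?a = "min (u (fst z)) (u (snd z))" and ?b = "max (u (fst z)) (u (snd z))"
    have "(\<integral>\<^sup>+t. F t z \<partial>lborel) = (\<integral>\<^sup>+t. ennreal (norm (fst z - snd z) powr (-p)) * indicator ?W z * indicator {?a..<?b} t \<partial>lborel)"
      unfolding F_def by (intro nn_integral_cong) (auto simp: indicator_def)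
    also have "\<dots> = ennreal (norm (fst z - snd z) powr (-p)) * indicator ?W z * emeasure lborel {?a..<?b}"
      by (rule nn_integral_cmult_indicator) simp
    also have "emeasure lborel {?a..<?b} = ennreal \<bar>u (fst z) - u (snd z)\<bar>"
      by (auto simp: min_def max_def)
    finally show "(\<integral>\<^sup>+t. F t z \<partial>lborel) = ennreal (\<bar>u (fst z) - u (snd z)\<bar> / norm (fst z - snd z) powr p) * indicator ?W z"
      by (cases "z \<in> ?W") (auto simp: ennreal_mult[symmetric] powr_minus_divide)
  qed
  finally show ?coarea by (simp add: p_def)
qed

text \<open>Chebyshev's bound \<open>t * g t powr \<theta> \<le> M\<close> turns \<open>t powr (q - 1) * g t powr (\<theta> * q)\<close>
  into at most \<open>M powr (q - 1) * g t powr \<theta>\<close>.\<close>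

lemma nn_integral_powr_le_of_level_sets:
  fixes u :: "'a::euclidean_space \<Rightarrow> real" and w :: "'a \<Rightarrow> ennreal" and \<Omega> :: "'a set" and \<theta> q A M :: real
  defines "g \<equiv> \<lambda>t. measure lborel {x \<in> \<Omega>. t < u x}"
  assumes u [measurable]: "u \<in> borel_measurable borel" and u0: "\<And>x. 0 \<le> u x"
    and w [measurable]: "w \<in> borel_measurable borel"
    and \<Omega> [measurable]: "\<Omega> \<in> sets borel" and fin: "emeasure lborel \<Omega> < \<infinity>"
    and q: "1 \<le> q" and A: "0 \<le> A" and M: "0 \<le> M"
    and level: "(\<integral>\<^sup>+t. ennreal (g t powr \<theta>) * indicator {0..} t \<partial>lborel) \<le> ennreal M"
    and weight: "\<And>S. S \<in> sets borel \<Longrightarrow> S \<subseteq> \<Omega> \<Longrightarrow>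
      (\<integral>\<^sup>+x. w x * indicator S x \<partial>lborel) \<le> ennreal (A * measure lborel S powr (\<theta> * q))"
    and \<theta>: "0 < \<theta>"
  shows "(\<integral>\<^sup>+x. ennreal (u x powr q) * w x * indicator \<Omega> x \<partial>lborel) \<le> ennreal (q * A * M powr q)"
proof -
  have E_borel: "{x \<in> \<Omega>. t < u x} \<in> sets borel" for t
  proof -
    have "{x \<in> \<Omega>. t < u x} = \<Omega> \<inter> {x \<in> space borel. t < u x}" by auto
    also have "\<dots> \<in> sets borel" by measurable
    finally show ?thesis .
  qed
  have \<Omega>_fm: "\<Omega> \<in> fmeasurable lborel" using fin by (intro fmeasurableI) auto
  have E_fm: "{x \<in> \<Omega>. t < u x} \<in> fmeasurable lborel" for t
    using E_borel[of t] by (intro fmeasurableI2[OF \<Omega>_fm]) auto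
  have g_mono: "g t \<le> g t'" if "t' \<le> t" for t t'
    unfolding g_def using that E_borel E_fm by (intro measure_mono_fmeasurable) auto
  have g_meas [measurable]: "g \<in> borel_measurable borel"
  proof -
    have "mono (\<lambda>t. - g t)" using g_mono by (auto simp: mono_def)
    then have "(\<lambda>t. - (- g t)) \<in> borel_measurable borel"
      by (intro borel_measurable_uminus borel_measurable_mono)
    then show ?thesis by simp
  qed
  \<comment> \<open>\<open>g\<close> is decreasing, so \<open>g t powr \<theta>\<close> bounds the
    integrand from below on \<open>{0..t}\<close>.\<close>
  have cheb: "t * g t powr \<theta> \<le> M" if "0 < t" for t
  proof -
    have "ennreal (t * g t powr \<theta>) = (\<integral>\<^sup>+s. ennreal (g t powr \<theta>) * indicator {0..t} s \<partial>lborel)"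
      using that by (subst nn_integral_cmult_indicator) (auto simp: ennreal_mult mult.commute)
    also have "\<dots> \<le> (\<integral>\<^sup>+s. ennreal (g s powr \<theta>) * indicator {0..} s \<partial>lborel)"
      using g_mono \<theta> by (intro nn_integral_mono) (auto simp: indicator_def g_def intro!: ennreal_leI powr_mono2)
    also have "\<dots> \<le> ennreal M" by (rule level)
    finally show ?thesis using M by (simp add: ennreal_le_iff)
  qed
  \<comment> \<open>Layer cake: integrating \<open>F\<close> in \<open>t\<close> gives
    \<open>u x powr q\<close> times the weight, integrating it in \<open>x\<close> gives the weight
    of a level set times \<open>q * t powr (q - 1)\<close>.\<close>
  define F where "F x t = (if x \<in> \<Omega> \<and> 0 < t \<and> t < u x then ennreal (q * t powr (q - 1)) * w x else 0)" for x t
  have [measurable]: "case_prod F \<in> borel_measurable (lborel \<Otimes>\<^sub>M lborel)"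
    unfolding F_def by measurable
  have "(\<integral>\<^sup>+x. ennreal (u x powr q) * w x * indicator \<Omega> x \<partial>lborel) = (\<integral>\<^sup>+x. (\<integral>\<^sup>+t. F x t \<partial>lborel) \<partial>lborel)"
  proof (intro nn_integral_cong)
    fix x
    have "((\<lambda>t. t powr (q - 1)) has_integral (u x powr (q - 1 + 1) / (q - 1 + 1))) {0..u x}"
      using q u0 by (intro has_integral_powr_from_0) auto
    from has_integral_mult_right[OF this, of q]
    have "((\<lambda>t. q * t powr (q - 1)) has_integral (u x powr q)) {0<..<u x}"
      using q by (simp add: has_integral_Icc_iff_Ioo)
    then have "(\<integral>\<^sup>+t. ennreal (q * t powr (q - 1)) * indicator {0<..<u x} t \<partial>lborel) = ennreal (u x powr q)"
      using q by (intro nn_integral_has_integral_lebesgue') auto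
    then have "ennreal (u x powr q) * w x * indicator \<Omega> x
        = (\<integral>\<^sup>+t. ennreal (q * t powr (q - 1)) * indicator {0<..<u x} t \<partial>lborel) * (w x * indicator \<Omega> x)"
      by (simp add: mult.assoc)
    also have "\<dots> = (\<integral>\<^sup>+t. ennreal (q * t powr (q - 1)) * indicator {0<..<u x} t * (w x * indicator \<Omega> x) \<partial>lborel)"
      by (rule nn_integral_multc[symmetric]) measurable
    also have "\<dots> = (\<integral>\<^sup>+t. F x t \<partial>lborel)"
      by (intro nn_integral_cong) (auto simp: F_def indicator_def)
    finally show "ennreal (u x powr q) * w x * indicator \<Omega> x = (\<integral>\<^sup>+t. F x t \<partial>lborel)" .
  qed
  also have "\<dots> = (\<integral>\<^sup>+t. (\<integral>\<^sup>+x. F x t \<partial>lborel) \<partial>lborel)"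
    by (rule lborel_pair.Fubini'[symmetric]) (simp add: case_prod_unfold)
  also have "\<dots> \<le> (\<integral>\<^sup>+t. ennreal (q * A * M powr (q - 1)) * (ennreal (g t powr \<theta>) * indicator {0..} t) \<partial>lborel)"
  proof (intro nn_integral_mono)
    fix t :: real
    show "(\<integral>\<^sup>+x. F x t \<partial>lborel) \<le> ennreal (q * A * M powr (q - 1)) * (ennreal (g t powr \<theta>) * indicator {0..} t)"
    proof (cases "0 < t")
      case True
      have "(\<integral>\<^sup>+x. F x t \<partial>lborel) = (\<integral>\<^sup>+x. ennreal (q * t powr (q - 1)) * (w x * indicator {x \<in> \<Omega>. t < u x} x) \<partial>lborel)"
        using True by (intro nn_integral_cong) (auto simp: F_def indicator_def)
      also have "\<dots> = ennreal (q * t powr (q - 1)) * (\<integral>\<^sup>+x. w x * indicator {x \<in> \<Omega>. t < u x} x \<partial>lborel)"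
        using E_borel[of t] by (intro nn_integral_cmult) auto
      also have "\<dots> \<le> ennreal (q * t powr (q - 1)) * ennreal (A * g t powr (\<theta> * q))"
        unfolding g_def by (intro mult_left_mono weight E_borel) auto
      also have "\<dots> = ennreal (q * A * (t powr (q - 1) * g t powr (\<theta> * q)))"
        using q A by (simp add: ennreal_mult[symmetric] mult_ac)
      also have "t powr (q - 1) * g t powr (\<theta> * q) = (t * g t powr \<theta>) powr (q - 1) * g t powr \<theta>"
      proof -
        have "g t powr (\<theta> * q) = g t powr (\<theta> * (q - 1)) * g t powr \<theta>"
          by (simp add: powr_add[symmetric] algebra_simps)
        then show ?thesis by (simp add: powr_mult powr_powr)
      qed
      also have "ennreal (q * A * ((t * g t powr \<theta>) powr (q - 1) * g t powr \<theta>))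
          \<le> ennreal (q * A * (M powr (q - 1) * g t powr \<theta>))"
        using cheb[OF True] True q A by (intro ennreal_leI mult_left_mono mult_right_mono powr_mono2) auto
      also have "\<dots> = ennreal (q * A * M powr (q - 1)) * (ennreal (g t powr \<theta>) * indicator {0..} t)"
        using True q A by (simp add: ennreal_mult[symmetric] mult_ac)
      finally show ?thesis .
    qed (simp add: F_def)
  qed
  also have "\<dots> = ennreal (q * A * M powr (q - 1)) * (\<integral>\<^sup>+t. ennreal (g t powr \<theta>) * indicator {0..} t \<partial>lborel)"
    by (rule nn_integral_cmult) measurable
  also have "\<dots> \<le> ennreal (q * A * M powr (q - 1)) * ennreal M"
    by (intro mult_left_mono level) simp
  also have "\<dots> = ennreal (q * A * M powr q)"
    using q A M powr_mult_base[of M "q - 1"] by (simp add: ennreal_mult[symmetric] mult_ac)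
  finally show ?thesis .
qed

text \<open>Inside the ball of radius \<open>R\<close> one has \<open>(norm x / R) powr (-\<alpha>) \<le> R / norm x\<close>, which does not
  depend on \<open>\<alpha>\<close> and is integrable, as the dimension is at least two.\<close>

lemma nn_integral_norm_powr_le:
  fixes S :: "'a::euclidean_space set" and \<alpha> :: real
  assumes n: "2 \<le> DIM('a)" and \<alpha>: "0 \<le> \<alpha>" "\<alpha> \<le> 1"
    and S: "S \<in> sets borel" and fin: "emeasure lborel S < \<infinity>"
  shows "(\<integral>\<^sup>+x. ennreal (1 / norm x powr \<alpha>) * indicator S x \<partial>lborel)
    \<le> ennreal ((1 + 4 * unit_ball_vol DIM('a)) * measure lborel S powr (1 - \<alpha> / DIM('a)))"
proof (cases "measure lborel S = 0")
  case True
  then have "emeasure lborel S = 0" using fin by (auto simp: measure_def enn2real_eq_0_iff)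
  then have "S \<in> null_sets lborel" using S by auto
  then have "(\<integral>\<^sup>+x. ennreal (1 / norm x powr \<alpha>) * indicator S x \<partial>lborel) = 0"
    by (rule nn_integral_null_set)
  then show ?thesis by simp
next
  case False
  let ?n = "DIM('a)"
  define \<omega> where "\<omega> = unit_ball_vol ?n"
  define m where "m = measure lborel S"
  \<comment> \<open>Up to a dimensional constant, the radius of a ball with the volume of
    \<open>S\<close>.\<close>
  define R where "R = m powr (1 / ?n)"
  have m: "0 < m" using False by (simp add: m_def zero_less_measure_iff)
  then have R: "0 < R" by (simp add: R_def)
  have Rn: "R ^ ?n = m" using m by (simp add: R_def powr_power)
  have \<omega>: "0 < \<omega>" by (simp add: \<omega>_def)
  \<comment> \<open>Outside the ball of radius \<open>R\<close> the weight is at most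
    \<open>R powr (-\<alpha>)\<close>. Inside, if
    \<open>R / 2 ^ (j + 1) \<le> norm x < R / 2 ^ j\<close>, the quotient \<open>R / norm x\<close>
    is at most \<open>2 ^ (j + 1)\<close>, which is the \<open>j\<close>-th term of the
    series.\<close>
  have "(\<integral>\<^sup>+x. ennreal (1 / norm x powr \<alpha>) * indicator S x \<partial>lborel)
      \<le> (\<integral>\<^sup>+x. ennreal (R powr (-\<alpha>)) * (indicator S x + (\<Sum>j. ennreal (2 ^ (j + 1)) * indicator (ball 0 (R / 2 ^ j)) x)) \<partial>lborel)"
  proof (intro nn_integral_mono)
    fix x :: 'a
    let ?s = "\<Sum>j. ennreal (2 ^ (j + 1)) * indicator (ball 0 (R / 2 ^ j)) x :: ennreal"
    \<comment> \<open>At the origin the weight has the value \<open>1 / 0 = 0\<close>, because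
      \<open>0 powr \<alpha> = 0\<close>.\<close>
    consider "x \<notin> S \<or> x = 0" | "x \<in> S" "R \<le> norm x" | "x \<in> S" "x \<noteq> 0" "norm x < R" by force
    then show "ennreal (1 / norm x powr \<alpha>) * indicator S x \<le> ennreal (R powr (-\<alpha>)) * (indicator S x + ?s)"
    proof cases
      case 2
      have "ennreal (1 / norm x powr \<alpha>) \<le> ennreal (R powr (-\<alpha>))"
        using 2 R \<alpha> by (auto simp: powr_minus_divide intro!: ennreal_leI divide_left_mono powr_mono2 mult_pos_pos)
      also have "\<dots> \<le> ennreal (R powr (-\<alpha>)) * (1 + ?s)"
        using mult_left_mono[of 1 "1 + ?s" "ennreal (R powr (-\<alpha>))"] by simp
      finally show ?thesis using 2 by simp
    next
      case 3
      have nx: "0 < norm x" using 3 by simp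
      obtain N where N: "R / norm x < 2 ^ N"
        using real_arch_pow[of 2 "R / norm x"] by auto
      obtain j where j: "R / norm x \<le> 2 ^ Suc j" "\<not> R / norm x \<le> 2 ^ j"
        using ex_least_nat_less[of "\<lambda>j. R / norm x \<le> 2 ^ j" N] N 3 nx by (auto simp: field_simps)
      have "1 / norm x powr \<alpha> = R powr (-\<alpha>) * (R / norm x) powr \<alpha>"
        using R nx by (simp add: powr_divide powr_minus)
      also have "(R / norm x) powr \<alpha> \<le> (R / norm x) powr 1"
        using 3 nx \<alpha> by (intro powr_mono) (auto simp: field_simps)
      also have "\<dots> \<le> 2 ^ (j + 1)" using j(1) R nx by simp
      finally have "ennreal (1 / norm x powr \<alpha>) \<le> ennreal (R powr (-\<alpha>) * 2 ^ (j + 1))"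
        by (intro ennreal_leI) (simp add: mult_left_mono)
      also have "\<dots> = ennreal (R powr (-\<alpha>)) * (ennreal (2 ^ (j + 1)) * indicator (ball 0 (R / 2 ^ j)) x)"
        using j(2) nx by (simp add: ennreal_mult field_simps)
      also have "\<dots> \<le> ennreal (R powr (-\<alpha>)) * ?s"
      proof (intro mult_left_mono)
        let ?f = "\<lambda>j. ennreal (2 ^ (j + 1)) * indicator (ball 0 (R / 2 ^ j)) x :: ennreal"
        have "sum ?f {j} \<le> suminf ?f" by (rule sum_le_suminf) (rule summableI, simp_all)
        then show "?f j \<le> suminf ?f" by (simp only: sum.insert sum.empty finite.emptyI empty_iff not_False_eq_True add_0_right)
      qed simp
      also have "\<dots> \<le> ennreal (R powr (-\<alpha>)) * (indicator S x + ?s)"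
        by (intro mult_left_mono) auto
      finally show ?thesis using 3 by simp
    qed auto
  qed
  also have "\<dots> = ennreal (R powr (-\<alpha>)) * (emeasure lborel S + (\<Sum>j. ennreal (2 ^ (j + 1)) * emeasure lborel (ball 0 (R / 2 ^ j) :: 'a set)))"
  proof -
    note [measurable] = S
    let ?f = "\<lambda>j x. ennreal (2 ^ (j + 1)) * indicator (ball 0 (R / 2 ^ j) :: 'a set) x"
    have f [measurable]: "?f j \<in> borel_measurable lborel" for j
      by (intro borel_measurable_times_ennreal borel_measurable_const borel_measurable_indicator) simp
    have "(\<integral>\<^sup>+x. (\<Sum>j. ?f j x) \<partial>lborel) = (\<Sum>j. \<integral>\<^sup>+x. ?f j x \<partial>lborel)"
      by (rule nn_integral_suminf[OF f])
    also have "\<dots> = (\<Sum>j. ennreal (2 ^ (j + 1)) * emeasure lborel (ball 0 (R / 2 ^ j) :: 'a set))"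
      by (intro suminf_cong nn_integral_cmult_indicator) simp
    finally have sum: "(\<integral>\<^sup>+x. (\<Sum>j. ?f j x) \<partial>lborel) = \<dots>" .
    have "(\<integral>\<^sup>+x. ennreal (R powr (-\<alpha>)) * (indicator S x + (\<Sum>j. ?f j x)) \<partial>lborel)
        = ennreal (R powr (-\<alpha>)) * (\<integral>\<^sup>+x. indicator S x + (\<Sum>j. ?f j x) \<partial>lborel)"
      by (rule nn_integral_cmult) measurable
    also have "(\<integral>\<^sup>+x. indicator S x + (\<Sum>j. ?f j x) \<partial>lborel)
        = (\<integral>\<^sup>+x. indicator S x \<partial>lborel) + (\<integral>\<^sup>+x. (\<Sum>j. ?f j x) \<partial>lborel)"
      by (rule nn_integral_add) measurable
    also have "(\<integral>\<^sup>+x. indicator S x \<partial>lborel) = emeasure lborel S"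
      using S by (intro nn_integral_indicator) simp
    finally show ?thesis unfolding sum .
  qed
  also have "\<dots> \<le> ennreal (R powr (-\<alpha>)) * (ennreal m + ennreal (4 * \<omega> * m))"
  proof (intro mult_left_mono add_mono)
    show "emeasure lborel S \<le> ennreal m"
      using fin by (simp add: m_def emeasure_eq_ennreal_measure)
    have "(\<Sum>j. ennreal (2 ^ (j + 1)) * emeasure lborel (ball 0 (R / 2 ^ j) :: 'a set))
        \<le> (\<Sum>j. ennreal (2 * \<omega> * m * (1 / 2) ^ j))"
    proof (intro suminf_le summableI)
      fix j :: nat
      have "(2 ^ (j + 1)) * (\<omega> * (R / 2 ^ j) ^ ?n) = 2 * \<omega> * m * (2 ^ j / (2 ^ j) ^ ?n)"
        by (simp add: power_divide Rn)
      \<comment> \<open>Dimension at least two is what makes the terms decay geometrically.\<close>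
      also have "2 ^ j / (2 ^ j) ^ ?n \<le> (2 ^ j / (2 ^ j) ^ 2 :: real)"
        using n by (intro divide_left_mono power_increasing) auto
      also have "(2 ^ j / (2 ^ j) ^ 2 :: real) = (1 / 2) ^ j"
        by (simp add: power2_eq_square power_one_over)
      finally show "ennreal (2 ^ (j + 1)) * emeasure lborel (ball 0 (R / 2 ^ j) :: 'a set) \<le> ennreal (2 * \<omega> * m * (1 / 2) ^ j)"
        using R \<omega> m by (simp add: emeasure_ball ennreal_mult[symmetric] \<omega>_def[symmetric] ennreal_leI)
    qed
    also have "\<dots> = ennreal (2 * \<omega> * m * 2)"
      using \<omega> m sums_mult[OF geometric_sums[of "1/2 :: real"], of "2 * \<omega> * m"]
      by (intro suminf_ennreal_eq) auto
    finally show "(\<Sum>j. ennreal (2 ^ (j + 1)) * emeasure lborel (ball 0 (R / 2 ^ j) :: 'a set)) \<le> ennreal (4 * \<omega> * m)"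
      by (simp add: mult_ac)
  qed simp
  also have "\<dots> = ennreal ((1 + 4 * \<omega>) * (R powr (-\<alpha>) * m))"
    using \<omega> m by (simp add: ennreal_mult[symmetric] ennreal_plus[symmetric] algebra_simps del: ennreal_plus)
  also have "R powr (-\<alpha>) * m = m powr (1 - \<alpha> / ?n)"
    using m by (simp add: R_def powr_powr powr_diff powr_minus_divide)
  finally show ?thesis by (simp add: \<omega>_def m_def)
qed

subsection \<open>The Poincare inequality\<close>

text \<open>The median is the infimum of the set \<open>T\<close> of levels above which at most half
  of the mass lies. The two inequalities are limits of those at \<open>m + e k\<close> and
  \<open>m - e k\<close> along increasing unions of level sets.\<close>

lemma (in finite_measure) median_exists:
  fixes f :: "'a \<Rightarrow> real"
  assumes f [measurable]: "f \<in> borel_measurable M" and pos: "0 < measure M (space M)"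
  obtains m where "2 * measure M {x \<in> space M. m < f x} \<le> measure M (space M)"
    and "2 * measure M {x \<in> space M. f x < m} \<le> measure M (space M)"
proof -
  let ?\<mu> = "measure M" and ?S = "space M"
  have split: "?\<mu> {x \<in> ?S. t < f x} = ?\<mu> ?S - ?\<mu> {x \<in> ?S. f x \<le> t}" for t
  proof -
    have "{x \<in> ?S. t < f x} = ?S - {x \<in> ?S. f x \<le> t}" by auto
    then show ?thesis by (simp add: finite_measure_compl)
  qed
  define T where "T = {t. 2 * ?\<mu> {x \<in> ?S. t < f x} \<le> ?\<mu> ?S}"
  have T_up: "t \<in> T" if "t' \<in> T" "t' \<le> t" for t t'
  proof -
    have "?\<mu> {x \<in> ?S. t < f x} \<le> ?\<mu> {x \<in> ?S. t' < f x}"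
      using that(2) by (intro finite_measure_mono) auto
    then show ?thesis using that(1) by (simp add: T_def)
  qed
  \<comment> \<open>High levels belong to \<open>T\<close> and very negative ones do not, since by
    \<open>pos\<close> half of the total mass is strictly less than all of it; so \<open>T\<close>
    has an infimum.\<close>
  have "(\<lambda>k. ?\<mu> {x \<in> ?S. f x \<le> real k}) \<longlonglongrightarrow> ?\<mu> (\<Union>k. {x \<in> ?S. f x \<le> real k})"
    by (intro finite_Lim_measure_incseq) (auto simp: incseq_def)
  also have "(\<Union>k. {x \<in> ?S. f x \<le> real k}) = ?S" by (auto intro: real_arch_simple)
  finally have "eventually (\<lambda>k. ?\<mu> ?S / 2 < ?\<mu> {x \<in> ?S. f x \<le> real k}) sequentially"
    by (rule order_tendstoD) (use pos in simp)
  then obtain k1 where "?\<mu> ?S / 2 < ?\<mu> {x \<in> ?S. f x \<le> real k1}"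
    by (auto dest: eventually_happens)
  then have T_ne: "real k1 \<in> T" by (simp add: T_def split)
  have "(\<lambda>k. ?\<mu> {x \<in> ?S. - real k < f x}) \<longlonglongrightarrow> ?\<mu> (\<Union>k. {x \<in> ?S. - real k < f x})"
    by (intro finite_Lim_measure_incseq) (auto simp: incseq_def)
  also have "(\<Union>k. {x \<in> ?S. - real k < f x}) = ?S"
  proof -
    have "\<exists>k. - real k < f x" for x
      using reals_Archimedean2[of "- f x"] by (auto simp: minus_less_iff)
    then show ?thesis by auto
  qed
  finally have "eventually (\<lambda>k. ?\<mu> ?S / 2 < ?\<mu> {x \<in> ?S. - real k < f x}) sequentially"
    by (rule order_tendstoD) (use pos in simp)
  then obtain k2 where "?\<mu> ?S / 2 < ?\<mu> {x \<in> ?S. - real k2 < f x}"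
    by (auto dest: eventually_happens)
  then have k2: "- real k2 \<notin> T" by (simp add: T_def)
  then have T_bdd: "bdd_below T"
    using T_up by (intro bdd_belowI[of _ "- real k2"]) (meson linear)
  define m where "m = Inf T"
  define e where "e k = 1 / (real k + 1)" for k
  have e: "0 < e k" "k \<le> l \<Longrightarrow> e l \<le> e k" for k l by (auto simp: e_def field_simps)
  have ex_e: "\<exists>k. e k < d" if "0 < d" for d
    using reals_Archimedean[OF that] by (auto simp: e_def inverse_eq_divide add.commute)
  show thesis
  proof
    have "(\<lambda>k. 2 * ?\<mu> {x \<in> ?S. m + e k < f x}) \<longlonglongrightarrow> 2 * ?\<mu> (\<Union>k. {x \<in> ?S. m + e k < f x})"
      by (intro tendsto_mult_left finite_Lim_measure_incseq)
         (use e(2) in \<open>auto simp: incseq_def intro: order.strict_trans1[rotated] add_left_mono\<close>)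
    also have "(\<Union>k. {x \<in> ?S. m + e k < f x}) = {x \<in> ?S. m < f x}"
    proof -
      have "(\<exists>k. m + e k < f x) \<longleftrightarrow> m < f x" for x
        using ex_e[of "f x - m"] e(1) by (smt (verit))
      then show ?thesis by auto
    qed
    finally show "2 * ?\<mu> {x \<in> ?S. m < f x} \<le> ?\<mu> ?S"
    proof (rule LIMSEQ_le_const2, intro exI allI impI)
      fix k
      obtain t where "t \<in> T" "t < m + e k"
        using cInf_lessD[of T "m + e k"] T_ne e(1)[of k] by (auto simp: m_def)
      then have "m + e k \<in> T" using T_up by (meson less_imp_le)
      then show "2 * ?\<mu> {x \<in> ?S. m + e k < f x} \<le> ?\<mu> ?S" by (simp add: T_def)
    qed
    have "(\<lambda>k. 2 * ?\<mu> {x \<in> ?S. f x \<le> m - e k}) \<longlonglongrightarrow> 2 * ?\<mu> (\<Union>k. {x \<in> ?S. f x \<le> m - e k})"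
      by (intro tendsto_mult_left finite_Lim_measure_incseq)
         (use e(2) in \<open>auto simp: incseq_def intro: order_trans diff_left_mono\<close>)
    also have "(\<Union>k. {x \<in> ?S. f x \<le> m - e k}) = {x \<in> ?S. f x < m}"
    proof -
      have "(\<exists>k. f x \<le> m - e k) \<longleftrightarrow> f x < m" for x
        using ex_e[of "m - f x"] e(1) by (smt (verit))
      then show ?thesis by auto
    qed
    finally show "2 * ?\<mu> {x \<in> ?S. f x < m} \<le> ?\<mu> ?S"
    proof (rule LIMSEQ_le_const2, intro exI allI impI)
      fix k
      \<comment> \<open>Below the infimum more than half of the mass lies above the level, hence
        less than half at or below it.\<close>
      have "m - e k \<notin> T" using cInf_lower[OF _ T_bdd, of "m - e k"] e(1)[of k] by (auto simp: m_def)
      then show "2 * ?\<mu> {x \<in> ?S. f x \<le> m - e k} \<le> ?\<mu> ?S" by (simp add: T_def split)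
    qed
  qed
qed

lemma lborel_median_exists:
  fixes f :: "'a::euclidean_space \<Rightarrow> real"
  assumes f [measurable]: "f \<in> borel_measurable borel" and B: "B \<in> sets borel"
    and fin: "emeasure lborel B < \<infinity>" "0 < measure lborel B"
  obtains m where "2 * measure lborel {x \<in> B. m < f x} \<le> measure lborel B"
    and "2 * measure lborel {x \<in> B. f x < m} \<le> measure lborel B"
proof -
  let ?R = "restrict_space lborel B"
  have eq: "measure ?R A = measure lborel A" if "A \<subseteq> B" for A
    using B that by (intro measure_restrict_space) auto
  interpret finite_measure ?R
    using B fin by (intro finite_measureI) (simp add: emeasure_restrict_space)
  have "f \<in> borel_measurable ?R" by (intro measurable_restrict_space1) simp
  moreover have space: "space ?R = B" by (simp add: space_restrict_space)
  ultimately obtain m where "2 * measure ?R {x \<in> B. m < f x} \<le> measure ?R B"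
    "2 * measure ?R {x \<in> B. f x < m} \<le> measure ?R B"
    using median_exists[of f] fin(2) eq[of B] by (auto simp only: space subset_refl)
  then show thesis
    using that by (simp add: eq)
qed

text \<open>The truncated seminorm as a single Borel integral over pairs, the form that the coarea
  formula produces; \<open>truncated_fractional_seminorm_eq\<close> links it to the iterated
  integral.\<close>

definition whitney_seminorm :: "real \<Rightarrow> real \<Rightarrow> 'a::euclidean_space set \<Rightarrow> ('a \<Rightarrow> real) \<Rightarrow> ennreal" where
  "whitney_seminorm \<delta> \<tau> \<Omega> u =
     (\<integral>\<^sup>+z. ennreal (\<bar>u (fst z) - u (snd z)\<bar> / norm (fst z - snd z) powr (real DIM('a) + \<delta>))
         * indicator (whitney_pairs \<tau> \<Omega>) z \<partial>lborel)"

text \<open>Meant for the positive and negative parts of \<open>f - m\<close>, whose increments are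
  at most those of \<open>f\<close>.\<close>

lemma whitney_seminorm_mono:
  assumes "\<And>x y. \<bar>u x - u y\<bar> \<le> \<bar>f x - f y\<bar>"
  shows "whitney_seminorm \<delta> \<tau> \<Omega> u \<le> whitney_seminorm \<delta> \<tau> \<Omega> f"
  unfolding whitney_seminorm_def
  by (intro nn_integral_mono mult_right_mono ennreal_leI divide_right_mono assms) auto

section \<open>Bounds for nonnegative functions that vanish on half of the central ball\<close>

locale distance_John_poincare =
  fixes \<Omega> :: "'a::euclidean_space set" and \<delta> \<tau> s C q \<alpha> :: real and xJ :: 'a
  assumes dim: "2 \<le> DIM('a)"
    and John: "distance_John_domain s C xJ \<Omega>"
    and \<tau>: "0 < \<tau>" "\<tau> < 1" and \<delta>: "0 < \<delta>" "\<delta> < 1"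
    and q: "1 \<le> q" "q \<le> DIM('a) / (s * (DIM('a) - \<delta>))"
    and \<alpha>: "\<alpha> = DIM('a) - s * q * (DIM('a) - \<delta>)"
begin

definition "\<theta> = s * (DIM('a) - \<delta>) / DIM('a)"

definition "weight_const = 1 + 4 * unit_ball_vol DIM('a)"

definition "B0 = ball xJ (\<tau> / 4 * bdry_dist \<Omega> xJ)"

abbreviation "iso_const \<equiv> isoperimetric_const DIM('a) \<tau> s C (diameter \<Omega>)"

lemma \<Omega>: "open \<Omega>" "bounded \<Omega>" "xJ \<in> \<Omega>" and s: "1 \<le> s"
  using John by (auto simp: distance_John_domain_def)

lemma \<Omega>_borel [measurable]: "\<Omega> \<in> sets borel"
  using \<Omega> by simp

lemma \<Omega>_finite: "emeasure lborel \<Omega> < \<infinity>"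
  using \<Omega> by (rule_tac emeasure_bounded_finite)

lemma \<Omega>_pos: "0 < measure lborel \<Omega>"
proof -
  have "\<not> negligible \<Omega>" using open_not_negligible[OF \<Omega>(1)] \<Omega>(3) by auto
  then have "emeasure lborel \<Omega> \<noteq> 0" using \<Omega>_borel by (auto simp: negligible_iff_emeasure0)
  then show ?thesis using \<Omega>_finite by (simp add: measure_def enn2real_positive_iff zero_less_iff_neq_zero)
qed

lemma sq_pos: "0 < DIM('a) - \<delta>" "0 < s * (DIM('a) - \<delta>)"
  using \<delta> dim s by auto

lemma q_bound: "s * q * (DIM('a) - \<delta>) \<le> DIM('a)"
  using q(2) sq_pos by (simp add: pos_le_divide_eq mult_ac)

lemma \<theta>: "0 < \<theta>" "\<theta> \<le> 1"
proof -
  show "0 < \<theta>" using sq_pos dim by (auto simp: \<theta>_def)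
  have "s * (DIM('a) - \<delta>) * 1 \<le> s * (DIM('a) - \<delta>) * q"
    using q(1) sq_pos by (intro mult_left_mono) auto
  then show "\<theta> \<le> 1" using q_bound dim by (auto simp: \<theta>_def mult_ac)
qed

text \<open>Since \<open>s\<close> and \<open>q\<close> are at least \<open>1\<close>,
  \<open>\<alpha>\<close> is at most \<open>\<delta>\<close>, so the weight estimate that is uniform
  in \<open>\<alpha>\<close> applies.\<close>

lemma \<alpha>_bounds: "0 \<le> \<alpha>" "\<alpha> \<le> 1"
proof -
  show "0 \<le> \<alpha>" using q_bound by (simp add: \<alpha>)
  have "1 * (DIM('a) - \<delta>) \<le> s * q * (DIM('a) - \<delta>)"
    using s q sq_pos mult_mono[of 1 s 1 q] by (intro mult_right_mono) auto
  then show "\<alpha> \<le> 1" using \<delta> by (simp add: \<alpha>)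
qed

text \<open>The weight exponent is tuned so that the weight of a set scales like the
  \<open>q\<close>-th power of its isoperimetric quantity.\<close>

lemma \<theta>q: "1 - \<alpha> / DIM('a) = \<theta> * q"
  using dim by (simp add: \<alpha> \<theta>_def diff_divide_distrib mult_ac)

text \<open>As \<open>n \<ge> 2\<close> and \<open>\<delta> < 1\<close>, \<open>n - \<delta>\<close>
  is at least \<open>n / 2\<close>. The bound serves to replace \<open>q\<close> and
  \<open>2 powr q\<close> in constants by numbers.\<close>

lemma q_le_2: "q \<le> 2"
proof -
  have "DIM('a) / 2 \<le> DIM('a) - \<delta>" using dim \<delta> by simp
  also have "\<dots> \<le> s * (DIM('a) - \<delta>)" using s sq_pos by (simp add: mult_le_cancel_right1)
  finally have "q * (DIM('a) / 2) \<le> q * (s * (DIM('a) - \<delta>))" using q by (intro mult_left_mono) auto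
  also have "\<dots> \<le> DIM('a)" using q_bound by (simp add: mult_ac)
  finally show ?thesis using dim by simp
qed

text \<open>For \<open>t \<ge> 0\<close> the level set meets \<open>B0\<close> inside
  \<open>{u > 0}\<close>, so every level inherits the smallness in the central ball. The
  isoperimetric inequality at each level is then integrated by the coarea formula.\<close>

lemma level_sets:
  assumes u [measurable]: "u \<in> borel_measurable borel" and u0: "\<And>x. 0 \<le> u x"
    and central: "2 * measure lborel {x \<in> B0. 0 < u x} \<le> measure lborel B0"
    and P: "whitney_seminorm \<delta> \<tau> \<Omega> u \<le> ennreal P" "0 \<le> P"
  shows "(\<integral>\<^sup>+t. ennreal (measure lborel {x \<in> \<Omega>. t < u x} powr \<theta>) * indicator {0..} t \<partial>lborel)
    \<le> ennreal (iso_const * (1 - \<delta>) * P)"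
proof -
  have E: "{x \<in> \<Omega>. t < u x} \<in> sets borel" for t
  proof -
    have "{x \<in> \<Omega>. t < u x} = \<Omega> \<inter> {x \<in> space borel. t < u x}" by auto
    also have "\<dots> \<in> sets borel" by measurable
    finally show ?thesis .
  qed
  have B0: "{x \<in> B0. 0 < u x} \<in> fmeasurable lborel"
  proof -
    have "{x \<in> B0. 0 < u x} = B0 \<inter> {x \<in> space lborel. 0 < u x}" by auto
    also have "\<dots> \<in> fmeasurable lborel"
      unfolding B0_def using emeasure_lborel_ball_finite
      by (intro fmeasurable_Int_fmeasurable fmeasurableI) auto
    finally show ?thesis .
  qed
  have "(\<integral>\<^sup>+t. ennreal (measure lborel {x \<in> \<Omega>. t < u x} powr \<theta>) * indicator {0..} t \<partial>lborel)
    \<le> (\<integral>\<^sup>+t. ennreal (iso_const * (1 - \<delta>)) * fractional_perimeter \<delta> \<tau> \<Omega> {x \<in> \<Omega>. t < u x} \<partial>lborel)"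
  proof (intro nn_integral_mono)
    fix t :: real
    show "ennreal (measure lborel {x \<in> \<Omega>. t < u x} powr \<theta>) * indicator {0..} t
      \<le> ennreal (iso_const * (1 - \<delta>)) * fractional_perimeter \<delta> \<tau> \<Omega> {x \<in> \<Omega>. t < u x}"
    proof (cases "0 \<le> t")
      case True
      have "measure lborel (B0 \<inter> {x \<in> \<Omega>. t < u x}) \<le> measure lborel {x \<in> B0. 0 < u x}"
        using True E by (intro measure_mono_fmeasurable B0) (auto simp: B0_def)
      then have "2 * measure lborel (B0 \<inter> {x \<in> \<Omega>. t < u x}) \<le> measure lborel B0"
        using central by simp
      then show ?thesis
        using distance_John_isoperimetric[OF John refl \<tau> \<delta> \<theta>(2)[unfolded \<theta>_def] E] True
        by (auto simp: B0_def \<theta>_def)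
    qed simp
  qed
  also have "\<dots> = ennreal (iso_const * (1 - \<delta>)) * whitney_seminorm \<delta> \<tau> \<Omega> u"
    unfolding whitney_seminorm_def nn_integral_fractional_perimeter[OF u \<Omega>_borel, symmetric]
    using borel_measurable_fractional_perimeter[OF u \<Omega>_borel] by (intro nn_integral_cmult) simp
  also have "\<dots> \<le> ennreal (iso_const * (1 - \<delta>)) * ennreal P"
    by (intro mult_left_mono P) simp
  finally show ?thesis
    using P(2) \<delta> isoperimetric_const_pos[of "DIM('a)" \<tau> s C "diameter \<Omega>"] by (simp add: ennreal_mult)
qed

lemma weight_bound:
  assumes "S \<in> sets borel" "S \<subseteq> \<Omega>"
  shows "(\<integral>\<^sup>+x. ennreal (1 / norm x powr \<alpha>) * indicator S x \<partial>lborel)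
    \<le> ennreal (weight_const * measure lborel S powr (\<theta> * q))"
proof -
  have "emeasure lborel S \<le> emeasure lborel \<Omega>" using assms by (intro emeasure_mono) auto
  then have "emeasure lborel S < \<infinity>" using \<Omega>_finite by simp
  then show ?thesis
    using nn_integral_norm_powr_le[OF dim \<alpha>_bounds assms(1)] by (simp add: weight_const_def \<theta>q)
qed

text \<open>Both bounds are instances of \<open>nn_integral_powr_le_of_level_sets\<close>: first
  with the singular weight and exponent \<open>q\<close>, then with weight and exponent
  \<open>1\<close>, where
  \<open>|S| \<le> |\<Omega>| powr (1 - \<theta>) * |S| powr \<theta>\<close> plays the role of the
  weight estimate.\<close>

lemma one_sided_bounds:
  assumes u [measurable]: "u \<in> borel_measurable borel" and u0: "\<And>x. 0 \<le> u x"
    and central: "2 * measure lborel {x \<in> B0. 0 < u x} \<le> measure lborel B0"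
    and P: "whitney_seminorm \<delta> \<tau> \<Omega> u \<le> ennreal P" "0 \<le> P"
  defines "M \<equiv> iso_const * (1 - \<delta>) * P"
  shows "(\<integral>\<^sup>+x. ennreal (u x powr q) * ennreal (1 / norm x powr \<alpha>) * indicator \<Omega> x \<partial>lborel)
      \<le> ennreal (2 * weight_const * M powr q)" (is ?A)
    and "(\<integral>\<^sup>+x. ennreal (u x) * indicator \<Omega> x \<partial>lborel)
      \<le> ennreal (measure lborel \<Omega> powr (1 - \<theta>) * M)" (is ?B)
proof -
  have M: "0 \<le> M"
    unfolding M_def using P(2) \<delta> isoperimetric_const_pos[of "DIM('a)" \<tau> s C "diameter \<Omega>"] by simp
  have wc: "0 \<le> weight_const" by (simp add: weight_const_def)
  note level = level_sets[OF u u0 central P, folded M_def]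
  have "(\<integral>\<^sup>+x. ennreal (u x powr q) * ennreal (1 / norm x powr \<alpha>) * indicator \<Omega> x \<partial>lborel)
      \<le> ennreal (q * weight_const * M powr q)"
    by (rule nn_integral_powr_le_of_level_sets[OF u u0 _ \<Omega>_borel \<Omega>_finite q(1) wc M level weight_bound \<theta>(1)]) auto
  also have "\<dots> \<le> ennreal (2 * weight_const * M powr q)"
    using q_le_2 wc by (intro ennreal_leI mult_right_mono) auto
  finally show ?A .
  have "(\<integral>\<^sup>+x. ennreal (u x powr 1) * 1 * indicator \<Omega> x \<partial>lborel)
      \<le> ennreal (1 * measure lborel \<Omega> powr (1 - \<theta>) * M powr 1)"
  proof (rule nn_integral_powr_le_of_level_sets[OF u u0 _ \<Omega>_borel \<Omega>_finite _ _ M level _ \<theta>(1)])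
    fix S assume S: "S \<in> sets borel" "S \<subseteq> \<Omega>"
    have le: "measure lborel S \<le> measure lborel \<Omega>"
      using S \<Omega>_finite by (intro measure_mono_fmeasurable fmeasurableI) auto
    have "emeasure lborel S \<le> emeasure lborel \<Omega>" using S by (intro emeasure_mono) auto
    then have fin: "emeasure lborel S \<noteq> \<infinity>" using \<Omega>_finite by auto
    have "measure lborel S = measure lborel S powr (1 - \<theta>) * measure lborel S powr \<theta>"
      by (simp add: powr_add[symmetric])
    also have "\<dots> \<le> measure lborel \<Omega> powr (1 - \<theta>) * measure lborel S powr \<theta>"
      using le \<theta> by (intro mult_right_mono powr_mono2) auto
    finally show "(\<integral>\<^sup>+x. 1 * indicator S x \<partial>lborel) \<le> ennreal (measure lborel \<Omega> powr (1 - \<theta>) * measure lborel S powr (\<theta> * 1))"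
      using S fin by (simp add: emeasure_eq_ennreal_measure ennreal_leI)
  qed auto
  then show ?B using u0 M by simp
qed

end

section \<open>From a median to functions of mean zero\<close>

context distance_John_poincare
begin

text \<open>The volume of \<open>\<Omega>\<close> cancels: the \<open>L1\<close> bounds carry
  \<open>|\<Omega>| powr (1 - \<theta>)\<close>, which leaves
  \<open>|m| * |\<Omega>| powr \<theta> \<le> 2 * M\<close>, and the weight of
  \<open>\<Omega>\<close> is at most a multiple of
  \<open>|\<Omega>| powr (\<theta> * q)\<close>.\<close>

lemma mean_zero_bound:
  fixes f :: "'a \<Rightarrow> real"
  assumes f [measurable]: "f \<in> borel_measurable borel"
    and int: "integrable lborel (\<lambda>x. indicator \<Omega> x * f x)"
    and mean: "(LINT x|lborel. indicator \<Omega> x * f x) = 0"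
    and P: "whitney_seminorm \<delta> \<tau> \<Omega> f \<le> ennreal P" "0 \<le> P"
  defines "M \<equiv> iso_const * (1 - \<delta>) * P"
  shows "(\<integral>\<^sup>+x. ennreal (\<bar>f x\<bar> powr q / norm x powr \<alpha>) * indicator \<Omega> x \<partial>lborel)
    \<le> ennreal (32 * weight_const * M powr q)"
proof -
  have M: "0 \<le> M"
    unfolding M_def using P(2) \<delta> isoperimetric_const_pos[of "DIM('a)" \<tau> s C "diameter \<Omega>"] by simp
  have wc: "0 \<le> weight_const" by (simp add: weight_const_def)
  have "0 < bdry_dist \<Omega> xJ" by (rule bdry_dist_pos[OF \<Omega>])
  then have "0 < measure lborel B0" using \<tau> by (simp add: B0_def)
  then obtain m where m: "2 * measure lborel {x \<in> B0. m < f x} \<le> measure lborel B0"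
    "2 * measure lborel {x \<in> B0. f x < m} \<le> measure lborel B0"
    using lborel_median_exists[OF f, of B0] emeasure_lborel_ball_finite by (auto simp: B0_def)
  define u where "u x = max (f x - m) 0" for x
  define v where "v x = max (m - f x) 0" for x
  have [measurable]: "u \<in> borel_measurable borel" "v \<in> borel_measurable borel"
    unfolding u_def v_def by measurable
  have u0: "0 \<le> u x" and v0: "0 \<le> v x" for x by (auto simp: u_def v_def)
  have uP: "whitney_seminorm \<delta> \<tau> \<Omega> u \<le> ennreal P"
    by (rule order_trans[OF whitney_seminorm_mono P(1)]) (auto simp: u_def)
  have vP: "whitney_seminorm \<delta> \<tau> \<Omega> v \<le> ennreal P"
    by (rule order_trans[OF whitney_seminorm_mono P(1)]) (auto simp: v_def)
  have uc: "2 * measure lborel {x \<in> B0. 0 < u x} \<le> measure lborel B0"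
    and vc: "2 * measure lborel {x \<in> B0. 0 < v x} \<le> measure lborel B0"
    using m by (simp_all add: u_def v_def less_max_iff_disj)
  have u: "(\<integral>\<^sup>+x. ennreal (u x powr q) * ennreal (1 / norm x powr \<alpha>) * indicator \<Omega> x \<partial>lborel)
      \<le> ennreal (2 * weight_const * M powr q)"
    "(\<integral>\<^sup>+x. ennreal (u x) * indicator \<Omega> x \<partial>lborel) \<le> ennreal (measure lborel \<Omega> powr (1 - \<theta>) * M)"
    unfolding M_def by (rule one_sided_bounds[OF _ u0 uc uP P(2)], measurable)+
  have v: "(\<integral>\<^sup>+x. ennreal (v x powr q) * ennreal (1 / norm x powr \<alpha>) * indicator \<Omega> x \<partial>lborel)
      \<le> ennreal (2 * weight_const * M powr q)"
    "(\<integral>\<^sup>+x. ennreal (v x) * indicator \<Omega> x \<partial>lborel) \<le> ennreal (measure lborel \<Omega> powr (1 - \<theta>) * M)"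
    unfolding M_def by (rule one_sided_bounds[OF _ v0 vc vP P(2)], measurable)+

  let ?\<mu> = "measure lborel \<Omega>"
  have "\<bar>m\<bar> * ?\<mu> \<le> 2 * (?\<mu> powr (1 - \<theta>) * M)"
  proof -
    have intm: "integrable lborel (\<lambda>x. indicator \<Omega> x * m)"
      using \<Omega>_finite by (intro integrable_mult_left integrable_real_indicator) auto
    \<comment> \<open>As \<open>f\<close> has mean zero, the integral of \<open>f - m\<close> over
      \<open>\<Omega>\<close> is \<open>- m * ?\<mu>\<close>.\<close>
    have "\<bar>m\<bar> * ?\<mu> = norm (LINT x|lborel. indicator \<Omega> x * f x - indicator \<Omega> x * m)"
      using mean by (subst Bochner_Integration.integral_diff[OF int intm]) (simp add: abs_mult)
    also have "ennreal \<dots> \<le> (\<integral>\<^sup>+x. ennreal (norm (indicator \<Omega> x * f x - indicator \<Omega> x * m)) \<partial>lborel)"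
      by (rule integral_norm_bound_ennreal[OF Bochner_Integration.integrable_diff[OF int intm]])
    also have "\<dots> = (\<integral>\<^sup>+x. ennreal (u x) * indicator \<Omega> x + ennreal (v x) * indicator \<Omega> x \<partial>lborel)"
      by (intro nn_integral_cong) (auto simp: indicator_def u_def v_def max_def)
    also have "\<dots> = (\<integral>\<^sup>+x. ennreal (u x) * indicator \<Omega> x \<partial>lborel) + (\<integral>\<^sup>+x. ennreal (v x) * indicator \<Omega> x \<partial>lborel)"
      by (rule nn_integral_add) measurable
    also have "\<dots> \<le> ennreal (?\<mu> powr (1 - \<theta>) * M) + ennreal (?\<mu> powr (1 - \<theta>) * M)"
      by (intro add_mono u v)
    also have "\<dots> = ennreal (2 * (?\<mu> powr (1 - \<theta>) * M))"
      using M by (simp add: ennreal_plus[symmetric] del: ennreal_plus)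
    finally show ?thesis using M by (simp add: ennreal_le_iff)
  qed
  moreover have "?\<mu> = ?\<mu> powr \<theta> * ?\<mu> powr (1 - \<theta>)"
    by (simp add: powr_add[symmetric])
  ultimately have "\<bar>m\<bar> * ?\<mu> powr \<theta> * ?\<mu> powr (1 - \<theta>) \<le> 2 * M * ?\<mu> powr (1 - \<theta>)"
    by (metis mult.assoc mult.commute)
  then have "\<bar>m\<bar> * ?\<mu> powr \<theta> \<le> 2 * M"
    using \<Omega>_pos by simp
  then have "(\<bar>m\<bar> * ?\<mu> powr \<theta>) powr q \<le> (2 * M) powr q"
    using q by (intro powr_mono2) auto
  moreover have two: "2 powr q \<le> (4 :: real)"
    using powr_mono[OF q_le_2, of 2] by simp
  ultimately have m_bound: "\<bar>m\<bar> powr q * ?\<mu> powr (\<theta> * q) \<le> 4 * M powr q"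
    using mult_right_mono[OF two, of "M powr q"] by (simp add: powr_mult powr_powr)

  let ?w = "\<lambda>x. ennreal (1 / norm x powr \<alpha>) * indicator \<Omega> x :: ennreal"
  have "(\<integral>\<^sup>+x. ennreal (\<bar>m\<bar> powr q) * ?w x \<partial>lborel) = ennreal (\<bar>m\<bar> powr q) * (\<integral>\<^sup>+x. ?w x \<partial>lborel)"
    by (rule nn_integral_cmult) measurable
  also have "\<dots> \<le> ennreal (\<bar>m\<bar> powr q) * ennreal (weight_const * ?\<mu> powr (\<theta> * q))"
    by (intro mult_left_mono weight_bound) auto
  also have "\<dots> = ennreal (weight_const * (\<bar>m\<bar> powr q * ?\<mu> powr (\<theta> * q)))"
    using wc by (simp add: ennreal_mult[symmetric] mult_ac)
  also have "\<dots> \<le> ennreal (weight_const * (4 * M powr q))"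
    by (intro ennreal_leI mult_left_mono m_bound wc)
  finally have const: "(\<integral>\<^sup>+x. ennreal (\<bar>m\<bar> powr q) * ?w x \<partial>lborel) \<le> ennreal (weight_const * (4 * M powr q))" .

  have "(\<integral>\<^sup>+x. ennreal (\<bar>f x\<bar> powr q / norm x powr \<alpha>) * indicator \<Omega> x \<partial>lborel)
      \<le> (\<integral>\<^sup>+x. 4 * (ennreal (u x powr q) * ?w x + (ennreal (v x powr q) * ?w x + ennreal (\<bar>m\<bar> powr q) * ?w x)) \<partial>lborel)"
  proof (intro nn_integral_mono)
    fix x
    \<comment> \<open>Comparing with the largest of the three terms costs only
      \<open>2 powr q \<le> 4\<close>: both \<open>f x - m\<close> and \<open>m - f x\<close> are at
      most \<open>b\<close>, and so is \<open>\<bar>m\<bar>\<close>.\<close>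
    define b where "b = max (u x) (max (v x) \<bar>m\<bar>)"
    have "u x \<le> b" "v x \<le> b" "\<bar>m\<bar> \<le> b" by (auto simp: b_def)
    moreover have "f x - m \<le> u x" "m - f x \<le> v x" by (auto simp: u_def v_def)
    ultimately have "\<bar>f x\<bar> \<le> 2 * b" by linarith
    then have "\<bar>f x\<bar> powr q \<le> (2 * b) powr q" using q by (intro powr_mono2) auto
    also have "\<dots> \<le> 4 * b powr q" using mult_right_mono[OF two, of "b powr q"] by (simp add: powr_mult)
    also have "\<dots> \<le> 4 * (u x powr q + (v x powr q + \<bar>m\<bar> powr q))" by (auto simp: b_def max_def)
    finally have "\<bar>f x\<bar> powr q / norm x powr \<alpha> \<le> 4 * (u x powr q + (v x powr q + \<bar>m\<bar> powr q)) / norm x powr \<alpha>"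
      by (intro divide_right_mono) auto
    then have "ennreal (\<bar>f x\<bar> powr q / norm x powr \<alpha>)
        \<le> ennreal (4 * (u x powr q * (1 / norm x powr \<alpha>) + (v x powr q * (1 / norm x powr \<alpha>) + \<bar>m\<bar> powr q * (1 / norm x powr \<alpha>))))"
      by (intro ennreal_leI) (simp add: add_divide_distrib algebra_simps)
    also have "\<dots> = 4 * (ennreal (u x powr q) * ennreal (1 / norm x powr \<alpha>) + (ennreal (v x powr q) * ennreal (1 / norm x powr \<alpha>) +
        ennreal (\<bar>m\<bar> powr q) * ennreal (1 / norm x powr \<alpha>)))"
      by (subst ennreal_mult) (auto simp: ennreal_mult[symmetric] ennreal_plus[symmetric] simp del: ennreal_plus)
    finally show "ennreal (\<bar>f x\<bar> powr q / norm x powr \<alpha>) * indicator \<Omega> x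
        \<le> 4 * (ennreal (u x powr q) * ?w x + (ennreal (v x powr q) * ?w x + ennreal (\<bar>m\<bar> powr q) * ?w x))"
      by (cases "x \<in> \<Omega>") auto
  qed
  also have "\<dots> = 4 * ((\<integral>\<^sup>+x. ennreal (u x powr q) * ?w x \<partial>lborel) +
      ((\<integral>\<^sup>+x. ennreal (v x powr q) * ?w x \<partial>lborel) + (\<integral>\<^sup>+x. ennreal (\<bar>m\<bar> powr q) * ?w x \<partial>lborel)))"
    by (simp add: nn_integral_cmult nn_integral_add)
  \<comment> \<open>The final \<open>32\<close> is \<open>4 * (2 + 2 + 4)\<close>.\<close>
  also have "\<dots> \<le> 4 * (ennreal (2 * weight_const * M powr q) + (ennreal (2 * weight_const * M powr q) + ennreal (weight_const * (4 * M powr q))))"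
    using u(1) v(1) const by (intro mult_left_mono add_mono) (auto simp: mult.assoc)
  also have "\<dots> = ennreal (4 * (2 * weight_const * M powr q + (2 * weight_const * M powr q + weight_const * (4 * M powr q))))"
    using wc by (subst ennreal_mult) (auto simp: ennreal_plus[symmetric] simp del: ennreal_plus)
  finally show ?thesis by (simp add: mult_ac)
qed

text \<open>Changing \<open>f\<close> on a null set affects neither the inner integral for a good
  \<open>y\<close> nor the outer one, so a Borel representative may be used; Tonelli's theorem then
  merges the two integrals.\<close>

lemma truncated_fractional_seminorm_eq:
  assumes g [measurable]: "g \<in> borel_measurable borel" and fg: "AE x in lborel. x \<in> \<Omega> \<longrightarrow> f x = g x"
  shows "truncated_fractional_seminorm \<delta> \<tau> \<Omega> f = whitney_seminorm \<delta> \<tau> \<Omega> g"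
proof -
  let ?n = "real DIM('a)"
  define F where "F y x = ennreal (\<bar>g x - g y\<bar> / norm (x - y) powr (?n + \<delta>)) * indicator (whitney_pairs \<tau> \<Omega>) (y, x)" for y x
  have meas: "(\<lambda>z. F (fst z) (snd z)) \<in> borel_measurable borel"
    unfolding F_def by measurable
  have "truncated_fractional_seminorm \<delta> \<tau> \<Omega> f = (\<integral>\<^sup>+y. (\<integral>\<^sup>+x. F y x \<partial>lborel) \<partial>lborel)"
    unfolding truncated_fractional_seminorm_def nn_integral_completion
  proof (rule nn_integral_cong_AE, use fg in eventually_elim)
    fix y assume y: "y \<in> \<Omega> \<longrightarrow> f y = g y"
    show "(\<integral>\<^sup>+x\<in>{x \<in> \<Omega>. norm (x - y) < \<tau> * bdry_dist \<Omega> y}.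
        ennreal (\<bar>f x - f y\<bar> / norm (x - y) powr (?n + \<delta>)) \<partial>lborel) * indicator \<Omega> y = (\<integral>\<^sup>+x. F y x \<partial>lborel)"
    proof (cases "y \<in> \<Omega>")
      case True
      have "(\<integral>\<^sup>+x\<in>{x \<in> \<Omega>. norm (x - y) < \<tau> * bdry_dist \<Omega> y}.
          ennreal (\<bar>f x - f y\<bar> / norm (x - y) powr (?n + \<delta>)) \<partial>lborel) = (\<integral>\<^sup>+x. F y x \<partial>lborel)"
        by (rule nn_integral_cong_AE, use fg in eventually_elim)
           (use True y in \<open>auto simp: F_def whitney_pairs_def indicator_def\<close>)
      then show ?thesis using True by simp
    qed (simp add: F_def whitney_pairs_def)
  qed
  also have "\<dots> = integral\<^sup>N (lborel \<Otimes>\<^sub>M lborel) (\<lambda>z. F (fst z) (snd z))"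
    using lborel.nn_integral_fst[of "\<lambda>z. F (fst z) (snd z)" lborel] meas by (simp add: lborel_prod)
  also have "\<dots> = whitney_seminorm \<delta> \<tau> \<Omega> g"
    by (simp add: lborel_prod whitney_seminorm_def F_def abs_minus_commute norm_minus_commute)
  finally show ?thesis .
qed

text \<open>Pass to a Borel representative of \<open>f\<close> on \<open>\<Omega>\<close>, which has
  the same integrals, and take the \<open>q\<close>-th root in
  \<open>mean_zero_bound\<close>.\<close>

lemma weighted_Lq_norm_le:
  assumes f: "f absolutely_integrable_on \<Omega>"
    and mean: "(LINT x:\<Omega>|lebesgue. f x) = 0"
  shows "weighted_Lq_norm q \<alpha> \<Omega> f
    \<le> ennreal (32 * weight_const * iso_const * (1 - \<delta>)) * truncated_fractional_seminorm \<delta> \<tau> \<Omega> f"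
proof -
  have wc: "1 \<le> weight_const" by (simp add: weight_const_def)
  have ic: "0 < iso_const" by (rule isoperimetric_const_pos)
  have f': "integrable lebesgue (\<lambda>x. indicator \<Omega> x * f x)"
    using f by (simp add: set_integrable_def)
  obtain g where g [measurable]: "g \<in> borel_measurable lborel" and g_eq: "AE x in lborel. indicator \<Omega> x * f x = g x"
    using completion_ex_borel_measurable_real[OF borel_measurable_integrable[OF f']] by blast
  have fg: "AE x in lborel. x \<in> \<Omega> \<longrightarrow> f x = g x"
    using g_eq by eventually_elim auto
  have g_ind: "AE x in lborel. indicator \<Omega> x * f x = indicator \<Omega> x * g x"
    using fg by eventually_elim (auto simp: indicator_def)
  have g_meas: "(\<lambda>x. indicator \<Omega> x * g x) \<in> borel_measurable lborel" by measurable
  have g_meas': "(\<lambda>x. indicator \<Omega> x * g x) \<in> borel_measurable lebesgue"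
    using g_meas by (rule measurable_completion)
  have ae: "AE x in lebesgue. indicator \<Omega> x * f x = indicator \<Omega> x * g x"
    using g_ind by (rule AE_completion)
  note f_meas = borel_measurable_integrable[OF f']
  have "integrable lebesgue (\<lambda>x. indicator \<Omega> x * g x)"
    using integrable_cong_AE[OF f_meas g_meas' ae] f' by (rule iffD1)
  then have int: "integrable lborel (\<lambda>x. indicator \<Omega> x * g x)"
    using integrable_completion[OF g_meas] by blast
  have "(LINT x|lborel. indicator \<Omega> x * g x) = (LINT x|lebesgue. indicator \<Omega> x * g x)"
    by (rule integral_completion[OF g_meas, symmetric])
  also have "\<dots> = (LINT x|lebesgue. indicator \<Omega> x * f x)"
    by (rule integral_cong_AE[OF f_meas g_meas' ae, symmetric])
  also have "\<dots> = 0" using mean by (simp add: set_lebesgue_integral_def)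
  finally have mean_g: "(LINT x|lborel. indicator \<Omega> x * g x) = 0" .
  have semi: "truncated_fractional_seminorm \<delta> \<tau> \<Omega> f = whitney_seminorm \<delta> \<tau> \<Omega> g"
    using g by (intro truncated_fractional_seminorm_eq fg) simp
  show ?thesis
  proof (cases "whitney_seminorm \<delta> \<tau> \<Omega> g")
    case top
    \<comment> \<open>The factor in front is positive, as \<open>\<delta> < 1\<close>, so the right
      side is infinite.\<close>
    then show ?thesis using wc ic \<delta> by (simp add: semi ennreal_mult_top)
  next
    case (real P)
    define M where "M = iso_const * (1 - \<delta>) * P"
    have M: "0 \<le> M" using ic \<delta> real by (simp add: M_def)
    define I where "I = (\<integral>\<^sup>+x\<in>\<Omega>. ennreal (\<bar>f x\<bar> powr q / norm x powr \<alpha>) \<partial>lebesgue)"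
    have "I = (\<integral>\<^sup>+x. ennreal (\<bar>g x\<bar> powr q / norm x powr \<alpha>) * indicator \<Omega> x \<partial>lborel)"
      unfolding I_def nn_integral_completion
      by (rule nn_integral_cong_AE, use fg in eventually_elim) (auto simp: indicator_def)
    also have "\<dots> \<le> ennreal (32 * weight_const * M powr q)"
      unfolding M_def using g real by (intro mean_zero_bound int mean_g) auto
    finally have I: "I \<le> ennreal (32 * weight_const * M powr q)" .
    then have fin: "I \<noteq> \<infinity>" by (auto simp: top_unique)
    have "enn2real I \<le> 32 * weight_const * M powr q"
      using I wc by (intro enn2real_leI) auto
    then have "enn2real I powr (1 / q) \<le> (32 * weight_const * M powr q) powr (1 / q)"
      using q by (intro powr_mono2) auto
    also have "\<dots> = (32 * weight_const) powr (1 / q) * M"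
      using q M by (simp add: powr_mult powr_powr)
    \<comment> \<open>The base is at least \<open>1\<close> and \<open>1 / q \<le> 1\<close>; this
      removes \<open>q\<close> from the constant.\<close>
    also have "\<dots> \<le> (32 * weight_const) powr 1 * M"
      using q wc M by (intro mult_right_mono powr_mono) auto
    also have "\<dots> = 32 * weight_const * iso_const * (1 - \<delta>) * P"
      using wc by (simp add: M_def)
    finally have "weighted_Lq_norm q \<alpha> \<Omega> f \<le> ennreal (32 * weight_const * iso_const * (1 - \<delta>) * P)"
      using fin by (simp add: weighted_Lq_norm_def ennreal_powr_def I_def[symmetric] ennreal_leI)
    then show ?thesis
      using real ic wc \<delta> by (simp add: semi ennreal_mult)
  qed
qed

end

theorem corollary1p6:
  fixes \<tau> s C\<^sub>J D :: real and n :: nat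
  assumes "n = CARD('n::finite)" and "n \<ge> 2"
    and "0 < \<tau>" and "\<tau> < 1" and "1 \<le> s" and "1 \<le> C\<^sub>J"
  shows "\<exists>C>0. \<forall>(\<delta>::real) (q::real) (\<alpha>::real) (\<Omega>::(real^'n) set) x\<^sub>J (f::real^'n \<Rightarrow> real).
     0 < \<delta> \<longrightarrow> \<delta> < 1 \<longrightarrow>
     s \<le> n / (n - \<delta>) \<longrightarrow>
     1 \<le> q \<longrightarrow> q \<le> n / (s * (n - \<delta>)) \<longrightarrow>
     \<alpha> = n - s * q * (n - \<delta>) \<longrightarrow>
     distance_John_domain s C\<^sub>J x\<^sub>J \<Omega> \<longrightarrow>
     diameter \<Omega> = D \<longrightarrow>
     f absolutely_integrable_on \<Omega> \<longrightarrow>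
     1 / measure lebesgue \<Omega> * (LINT x:\<Omega>|lebesgue. f x) = 0 \<longrightarrow>
     weighted_Lq_norm q \<alpha> \<Omega> f
       \<le> ennreal (C * (1 - \<delta>)) * truncated_fractional_seminorm \<delta> \<tau> \<Omega> f"
\<comment> \<open>The witness is built from \<open>n\<close>, \<open>\<tau>\<close>,
  \<open>s\<close>, \<open>C\<^sub>J\<close> and \<open>D\<close> alone, so it can be fixed before
  \<open>\<delta>\<close>, \<open>q\<close>, \<open>\<alpha>\<close>, the domain and
  \<open>f\<close>.\<close>
proof (intro exI[of _ "32 * (1 + 4 * unit_ball_vol n) * isoperimetric_const n \<tau> s C\<^sub>J D"] conjI allI impI)
  show "0 < 32 * (1 + 4 * unit_ball_vol n) * isoperimetric_const n \<tau> s C\<^sub>J D"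
    by (intro mult_pos_pos isoperimetric_const_pos add_pos_nonneg) auto
next
  fix \<delta> q \<alpha> :: real and \<Omega> :: "(real^'n) set" and x\<^sub>J and f :: "real^'n \<Rightarrow> real"
  assume H: "0 < \<delta>" "\<delta> < 1" "1 \<le> q" "q \<le> n / (s * (n - \<delta>))" "\<alpha> = n - s * q * (n - \<delta>)"
    "distance_John_domain s C\<^sub>J x\<^sub>J \<Omega>" "diameter \<Omega> = D" "f absolutely_integrable_on \<Omega>"
    and mean: "1 / measure lebesgue \<Omega> * (LINT x:\<Omega>|lebesgue. f x) = 0"
  have n: "DIM(real^'n) = n" using assms(1) by simp
  interpret distance_John_poincare \<Omega> \<delta> \<tau> s C\<^sub>J q \<alpha> x\<^sub>J
    using assms H by unfold_locales simp_all
  \<comment> \<open>The measure of \<open>\<Omega>\<close> is positive, so the factor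
    \<open>1 / measure lebesgue \<Omega>\<close> is not the default
    \<open>1 / 0 = 0\<close>.\<close>
  have "(LINT x:\<Omega>|lebesgue. f x) = 0"
    using mean \<Omega>_pos by simp
  from weighted_Lq_norm_le[OF H(8) this]
  show "weighted_Lq_norm q \<alpha> \<Omega> f \<le> ennreal (32 * (1 + 4 * unit_ball_vol n) * isoperimetric_const n \<tau> s C\<^sub>J D * (1 - \<delta>)) *
      truncated_fractional_seminorm \<delta> \<tau> \<Omega> f"
    unfolding n weight_const_def H(7) .
qed

end
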